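(* Let $p$ be an odd prime, let $G$ be a finite $p$-stable group, and let $P\in \mathrm{Syl}_p(G)$. Suppose that $C_G(O_p(G))\leq O_p(G)$. If $D$ is a strongly closed subgroup in $P$ (with respect to $G$), then $Z(J_o(D))$, $\Omega(Z(J_r(D)))$ and $\Omega(Z(J_e(D)))$ are normal subgroups of $G$.
   Context: All groups are finite. Conjugation: $U^g=g^{-1}Ug$. $p$-stable: a group $G$ is $p$-stable if whenever $Q$ is a $p$-subgroup of $G$, $g\in N_G(Q)$ and $[Q,g,g]=1$ (where $[Q,g,g]=[[Q,g],g]$), the coset $gC_G(Q)$ lies in $O_p(N_G(Q)/C_G(Q))$. Strongly closed: a nonempty subset (in particular a subgroup) $D$ of $P$ is strongly closed in $P$ with respect to $G$ if for all $U\subseteq D$ and $g\in G$ with $U^g\subseteq P$ one has $U^g\subseteq D$. Thompson subgroups: for a $p$-group $X$, let $d_r(X)$ be the maximal rank (minimal number of generators) of an abelian subgroup of $X$, $d_o(X)$ the maximal order of an abelian subgroup of $X$, and $d_e(X)$ the maximal order of an elementary abelian subgroup of $X$. Let $\mathcal A_r(X)$ be the set of abelian subgroups of $X$ of rank $d_r(X)$, $\mathcal A_o(X)$ the set of abelian subgroups of order $d_o(X)$, and $\mathcal A_e(X)$ the set of elementary abelian subgroups of order $d_e(X)$. For $x\in\{r,o,e\}$, $J_x(X)$ is the subgroup of $X$ generated by all members of $\mathcal A_x(X)$. For a $p$-group $X$, $\Omega(X)=\langle\{y\in X\mid y^p=1\}\rangle$, and $Z(X)$ is the center of $X$. *)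

theory Defs
  imports "HOL-Algebra.Sylow" "HOL-Algebra.Zassenhaus" "HOL-Algebra.Generated_Groups"
begin

text \<open>
  Throughout, subgroups are sets inside an ambient finite group \<open>G\<close>. The rank, the Thompson
  subgroups, the center and \<open>\<Omega>\<close> depend only on the subgroup, not on the ambient group.
\<close>

definition p_subgroup :: "nat \<Rightarrow> ('a, 'b) monoid_scheme \<Rightarrow> 'a set \<Rightarrow> bool" where
  "p_subgroup p G Q \<longleftrightarrow> subgroup Q G \<and> (\<exists>n. card Q = p ^ n)"

definition sylow_subgroup :: "nat \<Rightarrow> ('a, 'b) monoid_scheme \<Rightarrow> 'a set \<Rightarrow> bool" where
  "sylow_subgroup p G P \<longleftrightarrow> subgroup P G \<and> card P = p ^ multiplicity p (order G)"

text \<open>The subgroup \<open>O\<^sub>p(G)\<close>: the product of all normal \<open>p\<close>-subgroups, which for finite \<open>G\<close> is the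
  largest normal \<open>p\<close>-subgroup.\<close>

definition p_core :: "nat \<Rightarrow> ('a, 'b) monoid_scheme \<Rightarrow> 'a set" where
  "p_core p G = generate G (\<Union>{N. N \<lhd> G \<and> p_subgroup p G N})"

definition centralizer :: "('a, 'b) monoid_scheme \<Rightarrow> 'a set \<Rightarrow> 'a set" where
  "centralizer G S = {g \<in> carrier G. \<forall>s\<in>S. g \<otimes>\<^bsub>G\<^esub> s = s \<otimes>\<^bsub>G\<^esub> g}"

definition subgroup_center :: "('a, 'b) monoid_scheme \<Rightarrow> 'a set \<Rightarrow> 'a set" where
  "subgroup_center G H = {z \<in> H. \<forall>x\<in>H. z \<otimes>\<^bsub>G\<^esub> x = x \<otimes>\<^bsub>G\<^esub> z}"

text \<open>The subgroup \<open>[Q, g]\<close>, generated by the commutators \<open>[x, g] = x\<inverse> g\<inverse> x g\<close> with \<open>x \<in> Q\<close>.\<close>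

definition comm_subgroup :: "('a, 'b) monoid_scheme \<Rightarrow> 'a set \<Rightarrow> 'a \<Rightarrow> 'a set" where
  "comm_subgroup G Q g =
     generate G ((\<lambda>x. inv\<^bsub>G\<^esub> x \<otimes>\<^bsub>G\<^esub> inv\<^bsub>G\<^esub> g \<otimes>\<^bsub>G\<^esub> x \<otimes>\<^bsub>G\<^esub> g) ` Q)"

text \<open>The elements of \<^const>\<open>FactGroup\<close> are right cosets; since \<open>C\<^sub>G(Q)\<close> is normal in \<open>N\<^sub>G(Q)\<close>, the left
  coset below is one of them.\<close>

definition p_stable :: "nat \<Rightarrow> ('a, 'b) monoid_scheme \<Rightarrow> bool" where
  "p_stable p G \<longleftrightarrow>
     (\<forall>Q g. p_subgroup p G Q \<longrightarrow> g \<in> normalizer G Q \<longrightarrow>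
        comm_subgroup G (comm_subgroup G Q g) g = {\<one>\<^bsub>G\<^esub>} \<longrightarrow>
        g <#\<^bsub>G\<^esub> centralizer G Q \<in> p_core p (G\<lparr>carrier := normalizer G Q\<rparr> Mod centralizer G Q))"

definition strongly_closed :: "('a, 'b) monoid_scheme \<Rightarrow> 'a set \<Rightarrow> 'a set \<Rightarrow> bool" where
  "strongly_closed G P D \<longleftrightarrow>
     D \<noteq> {} \<and> D \<subseteq> P \<and>
     (\<forall>U g. U \<subseteq> D \<longrightarrow> g \<in> carrier G \<longrightarrow>
        inv\<^bsub>G\<^esub> g <#\<^bsub>G\<^esub> U #>\<^bsub>G\<^esub> g \<subseteq> P \<longrightarrow> inv\<^bsub>G\<^esub> g <#\<^bsub>G\<^esub> U #>\<^bsub>G\<^esub> g \<subseteq> D)"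

definition subgroup_rank :: "('a, 'b) monoid_scheme \<Rightarrow> 'a set \<Rightarrow> nat" where
  "subgroup_rank G A = (LEAST n. \<exists>S. S \<subseteq> A \<and> finite S \<and> card S = n \<and> generate G S = A)"

definition abelian_subgroups :: "('a, 'b) monoid_scheme \<Rightarrow> 'a set \<Rightarrow> 'a set set" where
  "abelian_subgroups G H = {A. subgroup A G \<and> A \<subseteq> H \<and> comm_group (G\<lparr>carrier := A\<rparr>)}"

definition elem_abelian_subgroups ::
    "nat \<Rightarrow> ('a, 'b) monoid_scheme \<Rightarrow> 'a set \<Rightarrow> 'a set set" where
  "elem_abelian_subgroups p G H =
     {A \<in> abelian_subgroups G H. \<forall>x\<in>A. x [^]\<^bsub>G\<^esub> p = \<one>\<^bsub>G\<^esub>}"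

definition d_r :: "('a, 'b) monoid_scheme \<Rightarrow> 'a set \<Rightarrow> nat" where
  "d_r G H = Max (subgroup_rank G ` abelian_subgroups G H)"

definition d_o :: "('a, 'b) monoid_scheme \<Rightarrow> 'a set \<Rightarrow> nat" where
  "d_o G H = Max (card ` abelian_subgroups G H)"

definition d_e :: "nat \<Rightarrow> ('a, 'b) monoid_scheme \<Rightarrow> 'a set \<Rightarrow> nat" where
  "d_e p G H = Max (card ` elem_abelian_subgroups p G H)"

definition A_r :: "('a, 'b) monoid_scheme \<Rightarrow> 'a set \<Rightarrow> 'a set set" where
  "A_r G H = {A \<in> abelian_subgroups G H. subgroup_rank G A = d_r G H}"

definition A_o :: "('a, 'b) monoid_scheme \<Rightarrow> 'a set \<Rightarrow> 'a set set" where
  "A_o G H = {A \<in> abelian_subgroups G H. card A = d_o G H}"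

definition A_e :: "nat \<Rightarrow> ('a, 'b) monoid_scheme \<Rightarrow> 'a set \<Rightarrow> 'a set set" where
  "A_e p G H = {A \<in> elem_abelian_subgroups p G H. card A = d_e p G H}"

definition J_r :: "('a, 'b) monoid_scheme \<Rightarrow> 'a set \<Rightarrow> 'a set" where
  "J_r G H = generate G (\<Union>(A_r G H))"

definition J_o :: "('a, 'b) monoid_scheme \<Rightarrow> 'a set \<Rightarrow> 'a set" where
  "J_o G H = generate G (\<Union>(A_o G H))"

definition J_e :: "nat \<Rightarrow> ('a, 'b) monoid_scheme \<Rightarrow> 'a set \<Rightarrow> 'a set" where
  "J_e p G H = generate G (\<Union>(A_e p G H))"

definition Omega :: "nat \<Rightarrow> ('a, 'b) monoid_scheme \<Rightarrow> 'a set \<Rightarrow> 'a set" where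
  "Omega p G H = generate G {y \<in> H. y [^]\<^bsub>G\<^esub> p = \<one>\<^bsub>G\<^esub>}"

end

theory Submission
  imports Defs "HOL-Algebra.Multiplicative_Group"
begin

text \<open>
  Let \<open>\<F>\<close> be the set of abelian subgroups of \<open>D\<close> that are maximal in one of the three senses. The
  subgroup in question is \<open>Z = {z \<in> \<Inter>\<F>. z\<^sup>m = \<one>}\<close>, where \<open>m = p\<close> for the rank and the elementary abelian
  version, and \<open>m = 0\<close>, which is no condition, for the order version: an element of \<open>D\<close> that
  centralizes a member of \<open>\<F>\<close> and satisfies \<open>z\<^sup>m = \<one>\<close> can be adjoined to that member, and maximality
  forces it to lie there already (\<open>torsion_center_generate\<close>, \<open>family_absorb\<close>). The normality of \<open>Z\<close> depends
  only on the fact that an abelian subgroup of \<open>D\<close> is again a member if it has at least the order of some member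
  \<open>A\<close>, at least as many solutions of \<open>x\<^sup>p = \<one>\<close>, and exponent dividing \<open>p\<close> in case \<open>A\<close> has. So the
  argument is carried out once, for such families.

  The first half of the argument shows \<open>Z \<le> O\<^sub>p(G)\<close>. As \<open>D\<close> is strongly closed, \<open>P\<close> normalizes \<open>D\<close> and
  hence \<open>Z\<close>; as \<open>Z\<close> is abelian, \<open>[O\<^sub>p(G), z, z] = 1\<close> for \<open>z \<in> Z\<close>. By \<open>p\<close>-stability \<open>z\<close> lies in the
  preimage of \<open>O\<^sub>p(G/C)\<close> with \<open>C = C\<^sub>G(O\<^sub>p(G)) \<le> O\<^sub>p(G)\<close>, and this preimage is a normal \<open>p\<close>-subgroup.

  The second half shows that \<open>W = Z \<inter> B\<close> is normal in \<open>G\<close> for each normal \<open>p\<close>-subgroup \<open>B\<close>, by induction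
  on \<open>|B|\<close> (\<open>conjugate_Z_Int_normal_p_subgroup\<close>). One may assume that \<open>B\<close> is generated by the conjugates
  of \<open>W\<close>; then \<open>B \<le> D\<close> by strong closure, and the induction hypothesis for \<open>B'\<close> gives \<open>B' \<le> Z\<close> and
  that \<open>B'\<close> centralizes \<open>B\<close>. Let \<open>L\<close> be the largest normal subgroup of \<open>G\<close> that normalizes \<open>W\<close>.
  A Frattini argument gives \<open>G = L N\<^sub>G(D \<inter> L)\<close>. If all members of \<open>\<F>\<close> lie in \<open>L\<close>, they are permuted by
  \<open>N\<^sub>G(D \<inter> L)\<close>, and \<open>W\<close> is normal. Otherwise take \<open>A \<in> \<F>\<close> not contained in \<open>L\<close> with \<open>A \<inter> B\<close> as large as
  possible. If \<open>B\<close> normalized \<open>A\<close>, then \<open>[B, A, A] = 1\<close> and \<open>p\<close>-stability would force \<open>A \<le> L\<close>. So \<open>B\<close> does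
  not normalize \<open>A\<close>, and Glauberman's replacement theorem (\<open>replacement_theorem\<close>) yields \<open>R \<in> \<F>\<close>
  that normalizes \<open>A\<close> and meets \<open>B\<close> in a larger subgroup; hence \<open>R \<le> L\<close>. All conjugates of \<open>W\<close> then lie
  in \<open>R\<close>, so \<open>B \<le> R\<close> normalizes \<open>A\<close> after all.
\<close>

section \<open>Fixed points of \<open>p\<close>-groups and conjugacy\<close>

lemma card_le_mult_fibre_bound:
  assumes "finite A" "finite B" "f \<in> A \<rightarrow> B"
    and "\<And>y. y \<in> B \<Longrightarrow> card {x \<in> A. f x = y} \<le> k"
  shows "card A \<le> k * card B"
proof (cases "B = {}")
  case True
  with assms(3) have "A = {}" by auto
  then show ?thesis by simp
next
  case False
  obtain y where y: "y \<in> B" "card A \<le> card (f -` {y} \<inter> A) * card B"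
    using pigeonhole_card[OF assms(3,1,2) False] by blast
  have "f -` {y} \<inter> A = {x \<in> A. f x = y}" by auto
  with y assms(4)[OF y(1)] show ?thesis
    by (metis le_trans mult_le_mono1)
qed

text \<open>The orbits without fixed points have length a positive power of \<open>p\<close>, by the orbit-stabilizer theorem.\<close>
lemma (in group_action) card_mod_prime_eq_card_fixed_points:
  assumes "Factorial_Ring.prime p" "order G = p ^ n" "finite E"
  shows "card E mod p = card {x \<in> E. \<forall>g\<in>carrier G. \<phi> g x = x} mod p"
proof -
  define Fix where "Fix = {x \<in> E. \<forall>g\<in>carrier G. \<phi> g x = x}"
  interpret group G using group_hom group_hom.axioms(1) by auto
  define f where "f x = (if x \<in> Fix then 0 else (1::nat))" for x
  have "p dvd (\<Sum>x\<in>orb. f x)" if orb: "orb \<in> orbits G E \<phi>" for orb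
  proof -
    obtain x where x: "x \<in> E" "orb = orbit G \<phi> x"
      using orb unfolding orbits_def by auto
    show ?thesis
    proof (cases "x \<in> Fix")
      case True
      then have "orb = {x}" 
        using orbit_refl[OF x(1)] unfolding x(2) orbit_def Fix_def by auto
      with True show ?thesis by (simp add: f_def)
    next
      case False
      have orbE: "orb \<subseteq> E" using x element_image unfolding orbit_def by auto
      have "y \<notin> Fix" if yo: "y \<in> orb" for y
      proof
        assume y: "y \<in> Fix"
        have "x \<in> orbit G \<phi> y"
          using orbit_sym x yo orbE by blast
        then have "x = y" using y unfolding orbit_def Fix_def by auto
        with y False show False by simp
      qed
      then have "(\<Sum>x\<in>orb. f x) = card orb" by (simp add: f_def)
      moreover have "card orb dvd p ^ n"
        using orbit_stabilizer_theorem[OF x(1)] assms(2) x(2) by (metis dvd_triv_left)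
      then obtain i where i: "card orb = p ^ i" using assms(1) divides_primepow_nat by blast
      moreover have "i \<noteq> 0"
      proof
        assume "i = 0"
        with i have "card orb = 1" by simp
        then have "orb = {x}" using orbit_refl[OF x(1)] x(2) by (metis card_1_singletonE singletonD)
        then have "x \<in> Fix" using x unfolding orbit_def Fix_def by auto
        with False show False by simp
      qed
      ultimately show ?thesis by simp
    qed
  qed
  then have "p dvd (\<Sum>orb\<in>orbits G E \<phi>. \<Sum>x\<in>orb. f x)" by (rule dvd_sum)
  then have "p dvd (\<Sum>x\<in>E. f x)" using disjoint_sum[OF assms(3), of f] by metis
  moreover have "(\<Sum>x\<in>E. f x) = (\<Sum>x\<in>E - Fix. f x)"
    using assms(3) by (intro sum.mono_neutral_right) (auto simp: f_def)
  then have "(\<Sum>x\<in>E. f x) = card (E - Fix)" by (simp add: f_def)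
  moreover have "card E = card Fix + card (E - Fix)"
    using assms(3) card_mono[of E Fix] by (subst card_Diff_subset) (auto simp: Fix_def)
  ultimately show ?thesis unfolding Fix_def[symmetric] by (metis mod_add_right_eq add_0_right mod_0_imp_dvd dvd_imp_mod_0)
qed

context group begin

lemma cancel_left [simp]:
  assumes "x \<in> carrier G" "y \<in> carrier G"
  shows "x \<otimes> (inv x \<otimes> y) = y" "inv x \<otimes> (x \<otimes> y) = y"
  using assms by (simp_all add: m_assoc[symmetric])

end

locale finite_group = group +
  assumes fin: "finite (carrier G)"
begin

lemma finite_subgroup: "subgroup H G \<Longrightarrow> finite H"
  using fin finite_subset subgroup.subset by blast

lemma card_subgroup_pos: "subgroup H G \<Longrightarrow> card H > 0"
  using finite_subgroup subgroup.one_closed card_gt_0_iff by blast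

lemma finite_group_subgroup: "subgroup H G \<Longrightarrow> finite_group (G\<lparr>carrier := H\<rparr>)"
  by (simp add: finite_group_def finite_group_axioms_def finite_subgroup subgroup_imp_group)

lemma lagrange_subgroup:
  assumes "subgroup H G" "subgroup K G" "H \<subseteq> K"
  shows "card (rcosets\<^bsub>G\<lparr>carrier := K\<rparr>\<^esub> H) * card H = card K"
proof -
  interpret K: finite_group "G\<lparr>carrier := K\<rparr>" using assms finite_group_subgroup by blast
  show ?thesis using K.lagrange[OF subgroup_incl[OF assms(1,2,3)]] by (simp add: order_def)
qed

lemma card_subgroup_dvd: "subgroup H G \<Longrightarrow> subgroup K G \<Longrightarrow> H \<subseteq> K \<Longrightarrow> card H dvd card K"
  using lagrange_subgroup by (metis dvd_triv_right)

text \<open>Right multiplication by \<open>q\<inverse>\<close> makes \<open>Q\<close> act on the right cosets of \<open>H\<close>; a coset \<open>H x\<close> is fixed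
  exactly if \<open>x Q x\<inverse> \<le> H\<close>. The next lemmas draw the two classical conclusions: a \<open>p\<close>-subgroup has a
  conjugate inside any subgroup of index prime to \<open>p\<close>, and normalizers grow in \<open>p\<close>-groups.\<close>
lemma card_rcosets_mod_prime:
  assumes "Factorial_Ring.prime p" "subgroup H G" "subgroup Q G" "card Q = p ^ n"
  shows "card (rcosets H) mod p = card {R \<in> rcosets H. \<forall>q\<in>Q. R #> q = R} mod p"
proof -
  interpret Q: finite_group "G\<lparr>carrier := Q\<rparr>" using assms finite_group_subgroup by blast
  define \<phi> where "\<phi> q = (\<lambda>R\<in>rcosets H. R #> inv q)" for q
  have Hc: "H \<subseteq> carrier G" using assms(2) subgroup.subset by blast
  have Qc: "q \<in> carrier G" if "q \<in> Q" for q using subgroup.mem_carrier[OF assms(3) that] .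
  have closed: "R #> q \<in> rcosets H" if R: "R \<in> rcosets H" and q: "q \<in> carrier G" for R q
  proof -
    obtain x where "x \<in> carrier G" "R = H #> x" using R unfolding RCOSETS_def by auto
    then show ?thesis using q Hc rcosetsI[of H] by (simp add: coset_mult_assoc)
  qed
  have sub: "R \<subseteq> carrier G" if "R \<in> rcosets H" for R
    using that rcosets_part_G[OF assms(2)] by blast
  have canc: "R #> q #> inv q = R" "R #> inv q #> q = R" if "R \<in> rcosets H" "q \<in> Q" for R q
    using sub[OF that(1)] Qc[OF that(2)] by (simp_all add: coset_mult_assoc)
  have bij: "\<phi> q \<in> Bij (rcosets H)" if q: "q \<in> Q" for q
  proof -
    have "bij_betw (\<phi> q) (rcosets H) (rcosets H)"
    proof (rule bij_betw_byWitness[of _ "\<lambda>R. R #> q"])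
      show "\<forall>a\<in>rcosets H. \<phi> q a #> q = a"
        using canc q by (simp add: \<phi>_def)
      show "\<forall>a'\<in>rcosets H. \<phi> q (a' #> q) = a'"
        using canc q closed Qc by (simp add: \<phi>_def)
      show "\<phi> q ` (rcosets H) \<subseteq> rcosets H" "(\<lambda>R. R #> q) ` (rcosets H) \<subseteq> rcosets H"
        using closed q Qc by (auto simp add: \<phi>_def)
    qed
    then show ?thesis unfolding Bij_def \<phi>_def by auto
  qed
  have hom: "\<phi> (a \<otimes> b) = compose (rcosets H) (\<phi> a) (\<phi> b)" if "a \<in> Q" "b \<in> Q" for a b
    unfolding \<phi>_def compose_def
    using that Qc closed sub by (intro restrict_ext) (simp add: coset_mult_assoc inv_mult_group)
  interpret act: group_action "G\<lparr>carrier := Q\<rparr>" "rcosets H" \<phi>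
    unfolding group_action_def group_hom_def group_hom_axioms_def hom_def
    using bij hom by (intro conjI Q.is_group group_BijGroup) (auto simp: BijGroup_def)
  have finr: "finite (rcosets H)" using fin finite_subset[OF rcosets_subset_PowG[OF assms(2)]] by simp
  have "card (rcosets H) mod p = card {R \<in> rcosets H. \<forall>q\<in>Q. \<phi> q R = R} mod p"
    using act.card_mod_prime_eq_card_fixed_points[OF assms(1) _ finr, of n] assms(4) by (simp add: order_def)
  moreover have "(\<forall>q\<in>Q. \<phi> q R = R) \<longleftrightarrow> (\<forall>q\<in>Q. R #> q = R)" if R: "R \<in> rcosets H" for R
    using R canc[OF R] by (metis \<phi>_def restrict_apply')
  then have "{R \<in> rcosets H. \<forall>q\<in>Q. \<phi> q R = R} = {R \<in> rcosets H. \<forall>q\<in>Q. R #> q = R}" by blast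
  ultimately show ?thesis by simp
qed

lemma fixed_coset_conj:
  assumes "subgroup H G" "x \<in> carrier G" "q \<in> carrier G" "H #> x #> q = H #> x"
  shows "x \<otimes> q \<otimes> inv x \<in> H"
proof -
  have Hc: "H \<subseteq> carrier G" using assms(1) subgroup.subset by blast
  have "H #> (x \<otimes> q) = H #> x" using assms Hc by (simp add: coset_mult_assoc)
  then have "x \<otimes> q \<in> H #> x" using rcos_self[OF m_closed[OF assms(2,3)] assms(1)] by simp
  then obtain h where "h \<in> H" "x \<otimes> q = h \<otimes> x" unfolding r_coset_def by auto
  moreover have "h \<otimes> x \<otimes> inv x = h" using \<open>h \<in> H\<close> assms(2) Hc by (simp add: m_assoc subset_iff)
  ultimately show ?thesis by simp
qed

lemma p_subgroup_conj_into:
  assumes "Factorial_Ring.prime p" "subgroup H G" "subgroup Q G" "card Q = p ^ n"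
    and "\<not> p dvd card (rcosets H)"
  obtains x where "x \<in> carrier G" "\<And>q. q \<in> Q \<Longrightarrow> x \<otimes> q \<otimes> inv x \<in> H"
proof -
  have "\<not> p dvd card {R \<in> rcosets H. \<forall>q\<in>Q. R #> q = R}"
    using card_rcosets_mod_prime[OF assms(1-4)] assms(5) by (simp add: dvd_eq_mod_eq_0)
  then have "{R \<in> rcosets H. \<forall>q\<in>Q. R #> q = R} \<noteq> {}" by (metis card.empty dvd_0_right)
  then obtain R where R: "R \<in> rcosets H" "\<forall>q\<in>Q. R #> q = R" by blast
  then obtain x where x: "x \<in> carrier G" "R = H #> x" unfolding RCOSETS_def by auto
  show ?thesis
    using that[OF x(1)] fixed_coset_conj[OF assms(2) x(1)] R(2) x(2) subgroup.mem_carrier[OF assms(3)]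
    by blast
qed

lemma exists_conj_into_outside:
  assumes "Factorial_Ring.prime p" "subgroup H G" "subgroup Q G" "card Q = p ^ n"
    and "Q \<subseteq> H" "p dvd card (rcosets H)"
  obtains x where "x \<in> carrier G" "x \<notin> H" "\<And>q. q \<in> Q \<Longrightarrow> x \<otimes> q \<otimes> inv x \<in> H"
proof -
  let ?F = "{R \<in> rcosets H. \<forall>q\<in>Q. R #> q = R}"
  have Hc: "H \<subseteq> carrier G" using assms(2) subgroup.subset by blast
  have d: "p dvd card ?F"
    using card_rcosets_mod_prime[OF assms(1-4)] assms(6) by (simp add: dvd_eq_mod_eq_0)
  have HF: "H \<in> ?F"
    using assms(5) coset_join2[OF _ assms(2)] Hc subgroup.subgroup_in_rcosets[OF assms(2) is_group] by auto
  have "?F \<noteq> {H}"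
  proof
    assume e: "?F = {H}"
    have "p dvd card {H}" using d unfolding e .
    then show False using assms(1) by simp
  qed
  then obtain R where R: "R \<in> rcosets H" "\<forall>q\<in>Q. R #> q = R" "R \<noteq> H" using HF by blast
  then obtain x where x: "x \<in> carrier G" "R = H #> x" unfolding RCOSETS_def by auto
  have "x \<notin> H" using R(3) x coset_join2[OF _ assms(2)] by auto
  then show ?thesis
    using that[OF x(1)] fixed_coset_conj[OF assms(2) x(1)] R(2) x(2) subgroup.mem_carrier[OF assms(3)]
    by blast
qed

text \<open>The version inside a subgroup \<open>X\<close> matters because the conjugating element is then found in \<open>X\<close>,
  which is what the Frattini argument needs.\<close>
lemma p_subgroup_conj_into_within:
  assumes "Factorial_Ring.prime p" "subgroup X G" "subgroup H G" "H \<subseteq> X" "subgroup Q G" "Q \<subseteq> X" "card Q = p ^ n"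
    and "card X = card H * m" "\<not> p dvd m"
  obtains x where "x \<in> X" "\<And>q. q \<in> Q \<Longrightarrow> x \<otimes> q \<otimes> inv x \<in> H"
proof -
  interpret X: finite_group "G\<lparr>carrier := X\<rparr>" using assms finite_group_subgroup by blast
  have "card (rcosets\<^bsub>G\<lparr>carrier := X\<rparr>\<^esub> H) = m"
    using lagrange_subgroup[OF assms(3,2,4)] assms(8) card_subgroup_pos[OF assms(3)] by simp
  with assms(9) obtain x where "x \<in> X" "\<And>q. q \<in> Q \<Longrightarrow> x \<otimes> q \<otimes> inv\<^bsub>G\<lparr>carrier := X\<rparr>\<^esub> x \<in> H"
    using X.p_subgroup_conj_into[OF assms(1) subgroup_incl[OF assms(3,2,4)] subgroup_incl[OF assms(5,2,6)] assms(7)]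
    by auto
  then show ?thesis using that m_inv_consistent[OF assms(2)] by metis
qed

text \<open>For \<open>Q = H\<close> this says that a proper subgroup of a \<open>p\<close>-group differs from its normalizer. The
  replacement theorem uses it with \<open>H\<close> the normalizer of \<open>Q\<close>.\<close>
lemma p_group_exists_conj_into_outside:
  assumes "Factorial_Ring.prime p" "subgroup X G" "card X = p ^ k" "subgroup H G" "H \<subseteq> X" "H \<noteq> X"
    and "subgroup Q G" "Q \<subseteq> H"
  obtains x where "x \<in> X" "x \<notin> H" "\<And>q. q \<in> Q \<Longrightarrow> x \<otimes> q \<otimes> inv x \<in> H"
proof -
  interpret X: finite_group "G\<lparr>carrier := X\<rparr>" using assms finite_group_subgroup by blast
  have l: "card (rcosets\<^bsub>G\<lparr>carrier := X\<rparr>\<^esub> H) * card H = p ^ k"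
    using lagrange_subgroup[OF assms(4,2,5)] assms(3) by simp
  have "card H < card X" using assms(5,6) finite_subgroup[OF assms(2)] by (simp add: psubset_card_mono)
  then have "card (rcosets\<^bsub>G\<lparr>carrier := X\<rparr>\<^esub> H) \<noteq> 1" using l assms(3) by auto
  moreover obtain i where "card (rcosets\<^bsub>G\<lparr>carrier := X\<rparr>\<^esub> H) = p ^ i"
    using l assms(1) divides_primepow_nat by (metis dvd_triv_left)
  ultimately have d: "p dvd card (rcosets\<^bsub>G\<lparr>carrier := X\<rparr>\<^esub> H)"
    by (metis dvd_power gr0I power_0)
  have QX: "Q \<subseteq> X" using assms by blast
  obtain j where "card Q = p ^ j"
    using card_subgroup_dvd[OF assms(7,2) QX] assms(1,3) divides_primepow_nat by metis
  then obtain x where "x \<in> X" "x \<notin> H" "\<And>q. q \<in> Q \<Longrightarrow> x \<otimes> q \<otimes> inv\<^bsub>G\<lparr>carrier := X\<rparr>\<^esub> x \<in> H"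
    using X.exists_conj_into_outside[OF assms(1) subgroup_incl[OF assms(4,2,5)] subgroup_incl[OF assms(7,2) QX] _ assms(8) d]
    by auto
  then show ?thesis using that m_inv_consistent[OF assms(2)] by metis
qed

lemma prime_order_imp_comm_group:
  assumes "Factorial_Ring.prime (order G)"
  shows "comm_group G"
proof -
  have "card (carrier G) > 1" using assms prime_gt_1_nat by (simp add: order_def)
  then obtain x where x: "x \<in> carrier G" "x \<noteq> \<one>"
    by (metis card_1_singleton_iff card_subgroup_pos less_irrefl one_closed subgroup_self subsetI subset_singletonD insert_iff One_nat_def empty_iff)
  have "card (generate G {x}) dvd order G"
    using card_subgroup_dvd[OF generate_is_subgroup subgroup_self generate_incl] x by (simp add: order_def)
  moreover have "card (generate G {x}) \<noteq> 1"
  proof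
    assume "card (generate G {x}) = 1"
    then obtain y where "generate G {x} = {y}" by (metis card_1_singletonE)
    moreover have "x \<in> generate G {x}" "\<one> \<in> generate G {x}" by (auto intro: generate.incl generate.one)
    ultimately show False using x by auto
  qed
  ultimately have "card (generate G {x}) = card (carrier G)"
    using assms by (metis order_def prime_nat_iff)
  then have "generate G {x} = carrier G"
    using card_subset_eq[OF fin generate_incl] x by blast
  then have e: "carrier G = range (\<lambda>n::int. x [^] n)" using generate_pow[OF x(1)] by (auto simp: full_SetCompr_eq)
  show ?thesis
  proof (rule group_comm_groupI)
    fix a b assume "a \<in> carrier G" "b \<in> carrier G"
    then obtain i j :: int where "a = x [^] i" "b = x [^] j" unfolding e by auto
    then show "a \<otimes> b = b \<otimes> a" using x(1) by (metis add.commute int_pow_mult)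
  qed
qed

lemma subgroup_normalizing:
  assumes "subgroup H G" "finite H"
  shows "subgroup {x \<in> carrier G. \<forall>h\<in>H. x \<otimes> h \<otimes> inv x \<in> H} G" (is "subgroup ?N G")
proof (rule subgroupI)
  show "?N \<subseteq> carrier G" by auto
  have Hc: "H \<subseteq> carrier G" using assms(1) subgroup.subset by blast
  have "\<one> \<in> ?N" using Hc by auto
  then show "?N \<noteq> {}" by blast
  fix x assume x: "x \<in> ?N"
  have "inj_on (\<lambda>h. x \<otimes> h \<otimes> inv x) H"
    using x Hc by (intro inj_onI) (simp add: subset_iff)
  then have s: "(\<lambda>h. x \<otimes> h \<otimes> inv x) ` H = H"
    using x assms(2) by (intro endo_inj_surj) auto
  have "inv x \<otimes> h \<otimes> inv (inv x) \<in> H" if h: "h \<in> H" for h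
  proof -
    obtain h' where h': "h' \<in> H" "h = x \<otimes> h' \<otimes> inv x" using s h by blast
    then have "inv x \<otimes> h \<otimes> inv (inv x) = h'" using x Hc by (simp add: m_assoc subset_iff)
    with h' show ?thesis by simp
  qed
  then show "inv x \<in> ?N" using x by auto
  fix y assume y: "y \<in> ?N"
  have "x \<otimes> y \<otimes> h \<otimes> inv (x \<otimes> y) \<in> H" if "h \<in> H" for h
  proof -
    have "x \<otimes> (y \<otimes> h \<otimes> inv y) \<otimes> inv x \<in> H" using x y that by auto
    then show ?thesis using x y that Hc by (simp add: m_assoc subset_iff inv_mult_group)
  qed
  then show "x \<otimes> y \<in> ?N" using x y by auto
qed

text \<open>A subgroup of index \<open>p\<close> exists by Sylow's theorem, is normal because normalizers grow, and has a
  quotient of prime order, which is abelian; so it contains the derived subgroup.\<close>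
lemma p_group_not_perfect:
  assumes p: "Factorial_Ring.prime p" and B: "subgroup B G" "card B = p ^ Suc n"
  shows "derived G B \<subset> B"
proof -
  interpret B: finite_group "G\<lparr>carrier := B\<rparr>" using B finite_group_subgroup by blast
  have "order (G\<lparr>carrier := B\<rparr>) = p ^ n * p" using B by (simp add: order_def)
  then obtain M where M: "subgroup M (G\<lparr>carrier := B\<rparr>)" "card M = p ^ n"
    using Sylow.sylow_thm[OF p B.is_group _ B.fin] by blast
  have MG: "subgroup M G" using incl_subgroup[OF B(1) M(1)] .
  have MB: "M \<subseteq> B" using subgroup.subset[OF M(1)] by simp
  have pn: "p ^ n < card B" using B(2) prime_gt_1_nat[OF p] by simp
  have "M \<noteq> B" using M(2) pn by auto
  define N where "N = {x \<in> B. \<forall>h\<in>M. x \<otimes> h \<otimes> inv x \<in> M}"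
  have N': "subgroup N (G\<lparr>carrier := B\<rparr>)"
    using B.subgroup_normalizing[OF M(1) finite_subgroup[OF MG]] m_inv_consistent[OF B(1)]
    unfolding N_def by (simp cong: conj_cong)
  have NG: "subgroup N G" using incl_subgroup[OF B(1) N'] .
  have MN: "M \<subseteq> N" unfolding N_def using MB MG by (auto simp: subgroup.m_closed subgroup.m_inv_closed)
  obtain x where x: "x \<in> B" "x \<notin> M" "\<And>q. q \<in> M \<Longrightarrow> x \<otimes> q \<otimes> inv x \<in> M"
    using p_group_exists_conj_into_outside[OF p B MG MB \<open>M \<noteq> B\<close> MG] by blast
  then have "M \<subset> N" using MN unfolding N_def by auto
  then have lt: "card M < card N" using finite_subgroup[OF NG] psubset_card_mono by blast
  have NB: "N \<subseteq> B" unfolding N_def by auto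
  obtain i where i: "card N = p ^ i" "i \<le> Suc n"
    using card_subgroup_dvd[OF NG B(1) NB] B(2) divides_primepow_nat[OF p] by metis
  have "n < i" using lt M(2) i(1) prime_gt_1_nat[OF p] by (simp add: power_strict_increasing_iff)
  then have "i = Suc n" using i(2) by simp
  with i have "card N = card B" using B(2) by simp
  then have NeB: "N = B" using card_subset_eq[OF finite_subgroup[OF B(1)] NB] by simp
  have nor: "M \<lhd> (G\<lparr>carrier := B\<rparr>)"
  proof (rule B.normal_invI[OF M(1)])
    fix x h assume "x \<in> carrier (G\<lparr>carrier := B\<rparr>)" "h \<in> M"
    then show "x \<otimes>\<^bsub>G\<lparr>carrier := B\<rparr>\<^esub> h \<otimes>\<^bsub>G\<lparr>carrier := B\<rparr>\<^esub> inv\<^bsub>G\<lparr>carrier := B\<rparr>\<^esub> x \<in> M"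
      using NeB unfolding N_def by (auto simp: m_inv_consistent[OF B(1)])
  qed
  have "card (rcosets\<^bsub>G\<lparr>carrier := B\<rparr>\<^esub> M) * p ^ n = p * p ^ n"
    using lagrange_subgroup[OF MG B(1) MB] M(2) B(2) by simp
  then have o: "order (G\<lparr>carrier := B\<rparr> Mod M) = p"
    using prime_gt_0_nat[OF p] by (simp add: order_def FactGroup_def)
  interpret Q: finite_group "G\<lparr>carrier := B\<rparr> Mod M"
    unfolding finite_group_def finite_group_axioms_def
    using normal.factorgroup_is_group[OF nor] o prime_gt_0_nat[OF p]
    by (metis order_def card_gt_0_iff)
  have "comm_group (G\<lparr>carrier := B\<rparr> Mod M)" using Q.prime_order_imp_comm_group o p by simp
  then have "derived G B \<subseteq> M" using derived_of_subgroup_minimal[OF nor B(1)] by simp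
  with MB \<open>M \<noteq> B\<close> show ?thesis by blast
qed

text \<open>For odd \<open>p\<close> the exponent of \<open>z\<close> is divisible by \<open>p\<close> when \<open>n = p\<close>; this is one of the two places where
  the oddness of \<open>p\<close> enters.\<close>
lemma pow_mult_central_commutator:
  assumes c: "x \<in> carrier G" "y \<in> carrier G" "z \<in> carrier G"
    and yx: "y \<otimes> x = x \<otimes> y \<otimes> z" and zx: "z \<otimes> x = x \<otimes> z" and zy: "z \<otimes> y = y \<otimes> z"
  shows "(x \<otimes> y) [^] (n::nat) = x [^] n \<otimes> y [^] n \<otimes> z [^] (n * (n - 1) div 2)"
proof (induction n)
  case 0 then show ?case by simp
next
  case (Suc n)
  note c' = c nat_pow_closed[OF c(1)] nat_pow_closed[OF c(2)] nat_pow_closed[OF c(3)]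
  have ynx: "y [^] n \<otimes> x = x \<otimes> (y [^] n \<otimes> z [^] n)" for n :: nat
  proof (induction n)
    case 0 then show ?case using c by simp
  next
    case (Suc n)
    have zyn: "z \<otimes> y [^] n = y [^] n \<otimes> z" using c zy by (metis group_commutes_pow)
    have "y [^] Suc n \<otimes> x = y [^] n \<otimes> x \<otimes> (y \<otimes> z)" using c' yx by (simp add: m_assoc)
    also have "\<dots> = x \<otimes> (y [^] n \<otimes> (z [^] n \<otimes> y) \<otimes> z)" using c' by (simp add: Suc.IH m_assoc)
    also have "z [^] n \<otimes> y = y \<otimes> z [^] n" using c zy by (metis group_commutes_pow)
    also have "x \<otimes> (y [^] n \<otimes> (y \<otimes> z [^] n) \<otimes> z) = x \<otimes> (y [^] Suc n \<otimes> z [^] Suc n)"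
      using c' by (simp add: m_assoc)
    finally show ?case .
  qed
  have zx': "z [^] (k::nat) \<otimes> x = x \<otimes> z [^] k" for k using c zx by (metis group_commutes_pow)
  have zy': "z [^] (k::nat) \<otimes> y = y \<otimes> z [^] k" for k using c zy by (metis group_commutes_pow)
  have zy'': "z [^] k \<otimes> (y \<otimes> w) = y \<otimes> (z [^] k \<otimes> w)" if "w \<in> carrier G" for w and k :: nat
    using c that zy'[of k] by (simp add: m_assoc[symmetric])
  let ?k = "n * (n - 1) div 2"
  have "(x \<otimes> y) [^] Suc n = x [^] n \<otimes> y [^] n \<otimes> (z [^] ?k \<otimes> x) \<otimes> y"
    using c' by (simp add: Suc.IH m_assoc)
  also have "\<dots> = x [^] n \<otimes> (y [^] n \<otimes> x) \<otimes> (z [^] ?k \<otimes> y)"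
    using c' by (simp add: zx' m_assoc)
  also have "\<dots> = x [^] Suc n \<otimes> y [^] Suc n \<otimes> z [^] (n + ?k)"
    using c' by (simp add: zy' zy'' ynx nat_pow_mult[symmetric] m_assoc)
  also have "n + ?k = Suc n * (Suc n - 1) div 2" by (cases n) auto
  finally show ?case .
qed

end

section \<open>Glauberman's replacement theorem\<close>

context group begin

definition conjugate :: "'a \<Rightarrow> 'a \<Rightarrow> 'a" where
  "conjugate g x = inv g \<otimes> x \<otimes> g"

definition commutator :: "'a \<Rightarrow> 'a \<Rightarrow> 'a" where
  "commutator x y = inv x \<otimes> conjugate y x"

definition abelian_subgroup :: "'a set \<Rightarrow> bool" where
  "abelian_subgroup A \<longleftrightarrow> subgroup A G \<and> (\<forall>x\<in>A. \<forall>y\<in>A. x \<otimes> y = y \<otimes> x)"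

text \<open>The value \<open>m = 0\<close> gives all of \<open>A\<close>. For abelian \<open>A\<close> and \<open>m = p\<close> the set is \<open>\<Omega>(A)\<close>.\<close>
definition torsion :: "nat \<Rightarrow> 'a set \<Rightarrow> 'a set" where
  "torsion m A = {x \<in> A. x [^] m = \<one>}"

lemma conjugate_closed [simp]: "g \<in> carrier G \<Longrightarrow> x \<in> carrier G \<Longrightarrow> conjugate g x \<in> carrier G"
  by (simp add: conjugate_def)

lemma conjugate_one [simp]: "g \<in> carrier G \<Longrightarrow> conjugate g \<one> = \<one>"
  "x \<in> carrier G \<Longrightarrow> conjugate \<one> x = x"
  by (simp_all add: conjugate_def)

lemma conjugate_mult:
  "g \<in> carrier G \<Longrightarrow> x \<in> carrier G \<Longrightarrow> y \<in> carrier G \<Longrightarrow>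
    conjugate g (x \<otimes> y) = conjugate g x \<otimes> conjugate g y"
  by (simp add: conjugate_def m_assoc)

lemma conjugate_inv:
  "g \<in> carrier G \<Longrightarrow> x \<in> carrier G \<Longrightarrow> conjugate g (inv x) = inv (conjugate g x)"
  by (simp add: conjugate_def m_assoc inv_mult_group)

lemma conjugate_conjugate:
  "g \<in> carrier G \<Longrightarrow> h \<in> carrier G \<Longrightarrow> x \<in> carrier G \<Longrightarrow>
    conjugate h (conjugate g x) = conjugate (g \<otimes> h) x"
  by (simp add: conjugate_def m_assoc inv_mult_group)

lemma conjugate_cancel [simp]:
  assumes "g \<in> carrier G" "x \<in> carrier G"
  shows "conjugate (inv g) (conjugate g x) = x" "conjugate g (conjugate (inv g) x) = x"
  using assms by (simp_all add: conjugate_conjugate)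

lemma conjugate_fixed_iff:
  assumes "g \<in> carrier G" "x \<in> carrier G"
  shows "conjugate g x = x \<longleftrightarrow> x \<otimes> g = g \<otimes> x"
proof -
  have "conjugate g x = x \<longleftrightarrow> g \<otimes> conjugate g x = g \<otimes> x"
    using assms by simp
  also have "g \<otimes> conjugate g x = x \<otimes> g"
    using assms by (simp add: conjugate_def m_assoc)
  finally show ?thesis .
qed

lemma conjugate_pow:
  assumes "g \<in> carrier G" "x \<in> carrier G"
  shows "conjugate g (x [^] (n::nat)) = conjugate g x [^] n"
  by (induction n) (use assms in \<open>simp_all add: conjugate_mult\<close>)

lemma commutator_closed [simp]:
  "x \<in> carrier G \<Longrightarrow> y \<in> carrier G \<Longrightarrow> commutator x y \<in> carrier G"
  by (simp add: commutator_def)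

lemma conjugate_eq_mult_commutator:
  "x \<in> carrier G \<Longrightarrow> y \<in> carrier G \<Longrightarrow> conjugate y x = x \<otimes> commutator x y"
  by (simp add: commutator_def)

lemma mult_eq_mult_commutator:
  "x \<in> carrier G \<Longrightarrow> y \<in> carrier G \<Longrightarrow> x \<otimes> y = y \<otimes> x \<otimes> commutator x y"
  by (simp add: commutator_def conjugate_def m_assoc)

lemma inj_on_conjugate: "g \<in> carrier G \<Longrightarrow> A \<subseteq> carrier G \<Longrightarrow> inj_on (conjugate g) A"
  by (metis conjugate_cancel(1) inj_on_inverseI subsetD)

lemma subgroup_conjugate:
  assumes "subgroup H G" "g \<in> carrier G"
  shows "subgroup (conjugate g ` H) G"
proof (rule subgroupI)
  have Hc: "H \<subseteq> carrier G" using assms(1) subgroup.subset by blast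
  show "conjugate g ` H \<subseteq> carrier G" using Hc assms(2) by auto
  show "conjugate g ` H \<noteq> {}" using subgroup.one_closed[OF assms(1)] by auto
  fix x assume "x \<in> conjugate g ` H"
  then obtain h where h: "h \<in> H" "x = conjugate g h" by auto
  show "inv x \<in> conjugate g ` H"
    using h Hc assms subgroup.m_inv_closed[OF assms(1) h(1)]
    by (intro image_eqI[of _ _ "inv h"]) (auto simp: conjugate_inv)
  fix y assume "y \<in> conjugate g ` H"
  then obtain k where k: "k \<in> H" "y = conjugate g k" by auto
  show "x \<otimes> y \<in> conjugate g ` H"
    using h k Hc assms subgroup.m_closed[OF assms(1) h(1) k(1)]
    by (intro image_eqI[of _ _ "h \<otimes> k"]) (auto simp: conjugate_mult subset_iff)
qed

lemma subgroup_centralizer: "S \<subseteq> carrier G \<Longrightarrow> subgroup (centralizer G S) G"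
proof (rule subgroupI)
  assume S: "S \<subseteq> carrier G"
  show "centralizer G S \<subseteq> carrier G" by (auto simp: centralizer_def)
  have "\<one> \<in> centralizer G S" using S by (auto simp: centralizer_def)
  then show "centralizer G S \<noteq> {}" by blast
  fix x assume x: "x \<in> centralizer G S"
  have "inv x \<otimes> s = s \<otimes> inv x" if "s \<in> S" for s
  proof -
    have "s \<in> carrier G" "x \<in> carrier G" "x \<otimes> s = s \<otimes> x" using x S that by (auto simp: centralizer_def)
    then show ?thesis by (metis inv_closed inv_solve_left inv_solve_right m_assoc m_closed)
  qed
  then show "inv x \<in> centralizer G S" using x by (simp add: centralizer_def)
  fix y assume y: "y \<in> centralizer G S"
  have "x \<otimes> y \<otimes> s = s \<otimes> (x \<otimes> y)" if "s \<in> S" for s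
  proof -
    have c: "s \<in> carrier G" "x \<in> carrier G" "x \<otimes> s = s \<otimes> x" "y \<in> carrier G" "y \<otimes> s = s \<otimes> y"
      using x y S that by (auto simp: centralizer_def)
    have "x \<otimes> y \<otimes> s = x \<otimes> (s \<otimes> y)" using c by (simp add: m_assoc)
    also have "\<dots> = x \<otimes> s \<otimes> y" using c(1,2,4) by (simp add: m_assoc)
    also have "\<dots> = s \<otimes> (x \<otimes> y)" unfolding c(3) using c(1,2,4) by (simp add: m_assoc)
    finally show ?thesis .
  qed
  then show "x \<otimes> y \<in> centralizer G S" using x y by (simp add: centralizer_def)
qed

text \<open>The centralizer of a set is a subgroup, so commuting passes to generated subgroups on either side.\<close>
lemma generate_commute:
  assumes "S \<subseteq> carrier G" "T \<subseteq> carrier G" "\<And>s t. s \<in> S \<Longrightarrow> t \<in> T \<Longrightarrow> s \<otimes> t = t \<otimes> s"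
    and "x \<in> generate G S" "y \<in> generate G T"
  shows "x \<otimes> y = y \<otimes> x"
proof -
  have "S \<subseteq> centralizer G T" using assms by (auto simp: centralizer_def)
  then have "generate G S \<subseteq> centralizer G T"
    using generate_subgroup_incl subgroup_centralizer[OF assms(2)] by blast
  then have "T \<subseteq> centralizer G (generate G S)" using assms(2) unfolding centralizer_def by fastforce
  then have "generate G T \<subseteq> centralizer G (generate G S)"
    using generate_subgroup_incl subgroup_centralizer generate_incl[OF assms(1)] by blast
  with assms(4,5) show ?thesis unfolding centralizer_def by fastforce
qed

lemma abelian_subgroup_generate:
  assumes "S \<subseteq> carrier G" "\<And>s t. s \<in> S \<Longrightarrow> t \<in> S \<Longrightarrow> s \<otimes> t = t \<otimes> s"
  shows "abelian_subgroup (generate G S)"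
proof -
  have "x \<otimes> y = y \<otimes> x" if "x \<in> generate G S" "y \<in> generate G S" for x y
    by (rule generate_commute[OF assms(1) assms(1) assms(2) that])
  then show ?thesis unfolding abelian_subgroup_def using generate_is_subgroup[OF assms(1)] by simp
qed

lemma subgroup_torsion:
  assumes "abelian_subgroup A"
  shows "subgroup (torsion m A) G"
proof (rule subgroupI)
  have A1: "subgroup A G" using assms unfolding abelian_subgroup_def by simp
  note A = A1 subgroup.mem_carrier[OF A1]
  show "torsion m A \<subseteq> carrier G" using A(2) by (auto simp: torsion_def)
  show "torsion m A \<noteq> {}" using subgroup.one_closed[OF A(1)] by (auto simp: torsion_def)
  show "inv x \<in> torsion m A" if "x \<in> torsion m A" for x
    using that A subgroup.m_inv_closed[OF A(1)] by (auto simp: torsion_def nat_pow_inv)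
  show "x \<otimes> y \<in> torsion m A" if "x \<in> torsion m A" "y \<in> torsion m A" for x y
    using that A subgroup.m_closed[OF A(1)] assms
    by (auto simp: torsion_def pow_mult_distrib abelian_subgroup_def)
qed

lemma abelian_subgroup_set_mult:
  assumes M: "abelian_subgroup M" and K: "abelian_subgroup K"
    and MK: "\<And>m k. m \<in> M \<Longrightarrow> k \<in> K \<Longrightarrow> m \<otimes> k = k \<otimes> m"
  shows "abelian_subgroup (M <#> K)"
proof -
  have s: "subgroup M G" "subgroup K G" using M K by (auto simp: abelian_subgroup_def)
  note c = subgroup.mem_carrier[OF s(1)] subgroup.mem_carrier[OF s(2)]
  have sw: "(m \<otimes> k) \<otimes> (m' \<otimes> k') = (m \<otimes> m') \<otimes> (k \<otimes> k')"
    if "m \<in> M" "k \<in> K" "m' \<in> M" "k' \<in> K" for m k m' k'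
  proof -
    have "(m \<otimes> k) \<otimes> (m' \<otimes> k') = m \<otimes> (k \<otimes> m') \<otimes> k'" using c that by (simp add: m_assoc)
    also have "k \<otimes> m' = m' \<otimes> k" using MK that by simp
    finally show ?thesis using c that by (simp add: m_assoc)
  qed
  have "subgroup (M <#> K) G"
  proof (rule subgroupI)
    show "M <#> K \<subseteq> carrier G" using c by (auto simp: set_mult_def)
    show "M <#> K \<noteq> {}" using s subgroup.one_closed by (fastforce simp: set_mult_def)
    fix x assume "x \<in> M <#> K"
    then obtain m k where mk: "m \<in> M" "k \<in> K" "x = m \<otimes> k" by (auto simp: set_mult_def)
    have "inv x = inv m \<otimes> inv k" using mk c MK by (metis inv_mult_group)
    then show "inv x \<in> M <#> K"
      unfolding set_mult_def
      using subgroup.m_inv_closed[OF s(1) mk(1)] subgroup.m_inv_closed[OF s(2) mk(2)] by blast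
    fix y assume "y \<in> M <#> K"
    then obtain m' k' where mk': "m' \<in> M" "k' \<in> K" "y = m' \<otimes> k'" by (auto simp: set_mult_def)
    show "x \<otimes> y \<in> M <#> K"
      unfolding mk(3) mk'(3) sw[OF mk(1,2) mk'(1,2)] set_mult_def
      using subgroup.m_closed[OF s(1) mk(1) mk'(1)] subgroup.m_closed[OF s(2) mk(2) mk'(2)] by blast
  qed
  moreover have "x \<otimes> y = y \<otimes> x" if x: "x \<in> M <#> K" and y: "y \<in> M <#> K" for x y
  proof -
    obtain m k where mk: "m \<in> M" "k \<in> K" "x = m \<otimes> k" using x by (auto simp: set_mult_def)
    obtain m' k' where mk': "m' \<in> M" "k' \<in> K" "y = m' \<otimes> k'" using y by (auto simp: set_mult_def)
    have "m \<otimes> m' = m' \<otimes> m" "k \<otimes> k' = k' \<otimes> k"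
      using M K mk mk' by (auto simp: abelian_subgroup_def)
    then show ?thesis
      unfolding mk(3) mk'(3) sw[OF mk(1,2) mk'(1,2)] sw[OF mk'(1,2) mk(1,2)] by simp
  qed
  ultimately show ?thesis by (simp add: abelian_subgroup_def)
qed

end

text \<open>
  The situation in which the replacement is built explicitly: \<open>B\<close> is a normal \<open>p\<close>-subgroup of class at
  most two with \<open>B' \<le> A\<close>, and \<open>b \<in> B\<close> is an element with \<open>A\<^sup>b \<le> N(A)\<close>. The replacement is
  \<open>M C\<^sub>A(M)\<close>, where \<open>M\<close> is generated by \<open>A \<inter> B\<close> and the commutators \<open>[b, a]\<close>.
\<close>
locale replacement = finite_group +
  fixes p k :: nat and A B :: "'a set" and b :: 'a
  assumes p: "Factorial_Ring.prime p" "odd p"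
    and A: "abelian_subgroup A"
    and B: "B \<lhd> G" "card B = p ^ k"
    and comm_in_A: "\<And>x y. x \<in> B \<Longrightarrow> y \<in> B \<Longrightarrow> commutator x y \<in> A"
    and comm_central: "\<And>x y z. x \<in> B \<Longrightarrow> y \<in> B \<Longrightarrow> z \<in> B \<Longrightarrow>
      commutator x y \<otimes> z = z \<otimes> commutator x y"
    and b: "b \<in> B"
    and conj_b_norm: "\<And>a x. a \<in> A \<Longrightarrow> x \<in> A \<Longrightarrow> conjugate (conjugate b a) x \<in> A"
begin

lemma A_sub: "subgroup A G" and A_comm: "x \<in> A \<Longrightarrow> y \<in> A \<Longrightarrow> x \<otimes> y = y \<otimes> x"
  using A by (auto simp: abelian_subgroup_def)
lemma B_sub: "subgroup B G" using B(1) normal_imp_subgroup by blast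
lemma A_carr: "x \<in> A \<Longrightarrow> x \<in> carrier G" using subgroup.mem_carrier[OF A_sub] .
lemma B_carr: "x \<in> B \<Longrightarrow> x \<in> carrier G" using subgroup.mem_carrier[OF B_sub] .
lemmas A_closed = subgroup.m_closed[OF A_sub] subgroup.m_inv_closed[OF A_sub]
lemmas B_closed = subgroup.m_closed[OF B_sub] subgroup.m_inv_closed[OF B_sub]
lemma B_conj: "g \<in> carrier G \<Longrightarrow> x \<in> B \<Longrightarrow> conjugate g x \<in> B"
  unfolding conjugate_def using normal.inv_op_closed1[OF B(1)] by simp
lemma comm_in_B: "x \<in> B \<Longrightarrow> y \<in> B \<Longrightarrow> commutator x y \<in> B"
  unfolding commutator_def using B_closed B_conj B_carr by simp
lemma A_fix: "x \<in> A \<Longrightarrow> a \<in> A \<Longrightarrow> conjugate a x = x"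
  using conjugate_fixed_iff A_carr A_comm by simp
lemma b_carr: "b \<in> carrier G" using B_carr b .

text \<open>The commutator \<open>[b, a] = b\<inverse> b\<^sup>a = (a\<inverse>)\<^sup>b a\<close>. The first form shows that it lies in \<open>B\<close>, the second
  that it normalizes \<open>A\<close>.\<close>
definition c :: "'a \<Rightarrow> 'a" where "c a = inv b \<otimes> conjugate a b"

lemma c_in_B: "a \<in> A \<Longrightarrow> c a \<in> B"
  unfolding c_def using B_closed b B_conj A_carr by simp

lemma c_carr: "a \<in> A \<Longrightarrow> c a \<in> carrier G" using c_in_B B_carr by blast

lemma c_alt: "a \<in> A \<Longrightarrow> c a = conjugate b (inv a) \<otimes> a"
  unfolding c_def using A_carr b_carr by (simp add: conjugate_def m_assoc)

lemma c_norm: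
  assumes "a \<in> A" "x \<in> A"
  shows "conjugate (c a) x \<in> A" "conjugate (inv (c a)) x \<in> A"
proof -
  note ca = A_carr[OF assms(1)] A_carr[OF assms(2)] b_carr
  have "conjugate (c a) x = conjugate a (conjugate (conjugate b (inv a)) x)"
    using ca assms(1) by (simp add: c_alt conjugate_conjugate)
  moreover have "conjugate (conjugate b (inv a)) x \<in> A" using conj_b_norm assms A_closed by blast
  ultimately show "conjugate (c a) x \<in> A" using A_fix assms by simp
  have "inv (c a) = inv a \<otimes> conjugate b a"
    using ca assms(1) by (simp add: c_alt conjugate_inv inv_mult_group)
  then have "conjugate (inv (c a)) x = conjugate (conjugate b a) (conjugate (inv a) x)"
    using ca by (simp add: conjugate_conjugate)
  also have "\<dots> = conjugate (conjugate b a) x" using A_fix assms A_closed by simp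
  finally show "conjugate (inv (c a)) x \<in> A" using conj_b_norm assms by simp
qed

lemma conj_c:
  assumes "a \<in> A" "x \<in> carrier G"
  shows "conjugate (c a) x = conjugate a (conjugate b (conjugate (inv a) (conjugate (inv b) x)))"
  using A_carr[OF assms(1)] b_carr assms(2)
  by (simp add: c_def conjugate_conjugate m_assoc conjugate_def inv_mult_group)

lemma conj_B_in_A:
  assumes "z \<in> A" "z \<in> B" "x \<in> B" shows "conjugate x z \<in> A"
  using assms A_closed comm_in_A A_carr B_carr by (simp add: conjugate_eq_mult_commutator)

text \<open>Conjugation by \<open>[b, a]\<close> is conjugation by \<open>b\<inverse>\<close>, \<open>a\<inverse>\<close>, \<open>b\<close> and \<open>a\<close> in turn. Since \<open>b\<close> maps
  \<open>A \<inter> B\<close> into \<open>A\<close>, on which \<open>a\<close> acts trivially, the effect on \<open>A \<inter> B\<close> is that of \<open>b\<inverse>\<close> followed by \<open>b\<close>.\<close>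
lemma A_Int_B_commute_c:
  assumes "z \<in> A" "z \<in> B" "a \<in> A"
  shows "z \<otimes> c a = c a \<otimes> z"
proof -
  note ca = A_carr[OF assms(1)] A_carr[OF assms(3)] b_carr
  have w: "conjugate (inv b) z \<in> A" using conj_B_in_A assms(1,2) B_closed b by simp
  have "conjugate (c a) z = z"
    using ca assms by (simp add: conj_c A_fix[OF w] A_closed A_fix)
  then show ?thesis using conjugate_fixed_iff ca c_carr[OF assms(3)] by simp
qed

lemma commutator_central_mult:
  assumes "e \<in> B" "t \<in> B" "\<And>z. z \<in> B \<Longrightarrow> t \<otimes> z = z \<otimes> t"
  shows "commutator (e \<otimes> t) b = commutator e b"
proof -
  note ca = B_carr[OF assms(1)] B_carr[OF assms(2)] b_carr
  have "conjugate b t = t" using conjugate_fixed_iff ca assms(3)[OF b] by simp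
  then have "commutator (e \<otimes> t) b = inv t \<otimes> (inv e \<otimes> conjugate b e) \<otimes> t"
    using ca by (simp add: commutator_def conjugate_mult inv_mult_group m_assoc)
  also have "\<dots> = inv t \<otimes> (t \<otimes> (inv e \<otimes> conjugate b e))"
    using ca assms(3)[of "inv e \<otimes> conjugate b e"] B_closed B_conj[OF b_carr] assms(1)
    by (simp add: m_assoc)
  finally show ?thesis using ca by (simp add: commutator_def)
qed

text \<open>
  This is where \<open>p\<close> odd is essential. Put \<open>e\<^sub>1\<^sub>2 = [c\<^sub>1, a\<^sub>2]\<close> with \<open>c\<^sub>i = [b, a\<^sub>i]\<close>. A computation in the
  class-two group \<open>B\<close>, using that \<open>a\<^sub>2\<close> acts trivially on \<open>e\<^sub>1\<^sub>2 \<in> A \<inter> B\<close> and on \<open>B'\<close>, gives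
  \<open>[c\<^sub>1, c\<^sub>2] = [e\<^sub>1\<^sub>2, b]\<inverse>\<close>. Modulo the central subgroup \<open>B'\<close> the element \<open>e\<^sub>1\<^sub>2\<close> is symmetric in the indices,
  because \<open>a\<^sub>1\<close> and \<open>a\<^sub>2\<close> commute. Hence \<open>[c\<^sub>1, c\<^sub>2] = [c\<^sub>2, c\<^sub>1]\<close>, so the square of this commutator is \<open>1\<close>,
  and it lies in a group of odd order.
\<close>
lemma c_commute:
  assumes a1: "a1 \<in> A" and a2: "a2 \<in> A"
  shows "c a1 \<otimes> c a2 = c a2 \<otimes> c a1"
proof -
  \<comment> \<open>The commutator \<open>[c a1, a2]\<close>\<close>
  define e where "e a1 a2 = inv (c a1) \<otimes> conjugate a2 (c a1)" for a1 a2
  have eB: "e a1 a2 \<in> B" if "a1 \<in> A" "a2 \<in> A" for a1 a2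
    using that c_in_B B_closed B_conj A_carr by (simp add: e_def)
  have eA: "e a1 a2 \<in> A" if "a1 \<in> A" "a2 \<in> A" for a1 a2
  proof -
    have "e a1 a2 = conjugate (c a1) (inv a2) \<otimes> a2"
      using that c_carr A_carr by (simp add: e_def conjugate_def m_assoc)
    then show ?thesis using that A_closed c_norm by simp
  qed
  have key: "conjugate (c a2) (c a1) = c a1 \<otimes> inv (commutator (e a1 a2) b)"
    if a: "a1 \<in> A" "a2 \<in> A" for a1 a2
  proof -
    note ca = A_carr[OF a(1)] A_carr[OF a(2)] b_carr c_carr[OF a(1)] c_carr[OF a(2)] B_carr[OF eB[OF a]]
    define t where "t = commutator (c a1) (inv b)"
    have tA: "t \<in> A" and tB: "t \<in> B" and tc: "\<And>z. z \<in> B \<Longrightarrow> t \<otimes> z = z \<otimes> t"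
      unfolding t_def using comm_in_A comm_in_B comm_central c_in_B[OF a(1)] B_closed b by simp_all
    define s where "s = commutator (e a1 a2) b"
    have sA: "s \<in> A" and sB: "s \<in> B" and sc: "\<And>z. z \<in> B \<Longrightarrow> s \<otimes> z = z \<otimes> s"
      unfolding s_def using comm_in_A comm_in_B comm_central eB[OF a] b by simp_all
    note ca = ca B_carr[OF tB] B_carr[OF sB]
    have cs: "conjugate g (inv s) = inv s" if "g \<in> A" for g
      using that sA A_closed A_fix by simp
    have ie: "conjugate (inv a2) (c a1) = c a1 \<otimes> inv (e a1 a2)"
    proof -
      have "e a1 a2 = conjugate (inv a2) (e a1 a2)" using eA[OF a] A_fix A_closed a by simp
      also have "\<dots> = inv (conjugate (inv a2) (c a1)) \<otimes> c a1"
        using ca by (simp add: e_def conjugate_mult conjugate_inv)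
      finally have "inv (e a1 a2) = inv (c a1) \<otimes> conjugate (inv a2) (c a1)"
        using ca by (simp add: inv_mult_group)
      then show ?thesis using ca by simp
    qed
    have w: "conjugate (inv b) (c a1) = c a1 \<otimes> t"
      unfolding t_def using ca by (simp add: conjugate_eq_mult_commutator)
    have "conjugate (inv a2) (conjugate (inv b) (c a1)) = conjugate (inv a2) (c a1) \<otimes> t"
      unfolding w using ca A_fix[OF tA] A_closed a by (simp add: conjugate_mult)
    also have "\<dots> = c a1 \<otimes> (inv (e a1 a2) \<otimes> t)" unfolding ie using ca by (simp add: m_assoc)
    also have "inv (e a1 a2) \<otimes> t = t \<otimes> inv (e a1 a2)" using tc eB[OF a] B_closed by simp
    also have "c a1 \<otimes> (t \<otimes> inv (e a1 a2)) = conjugate (inv b) (c a1) \<otimes> inv (e a1 a2)"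
      unfolding w using ca by (simp add: m_assoc)
    finally have "conjugate b (conjugate (inv a2) (conjugate (inv b) (c a1)))
        = c a1 \<otimes> inv (conjugate b (e a1 a2))"
      using ca by (simp add: conjugate_mult conjugate_inv)
    also have "conjugate b (e a1 a2) = e a1 a2 \<otimes> s"
      unfolding s_def using ca by (simp add: conjugate_eq_mult_commutator)
    also have "e a1 a2 \<otimes> s = s \<otimes> e a1 a2" using sc eB[OF a] by simp
    also have "c a1 \<otimes> inv (s \<otimes> e a1 a2) = conjugate (inv a2) (c a1) \<otimes> inv s"
      unfolding ie using ca by (simp add: m_assoc inv_mult_group)
    finally have "conjugate (c a2) (c a1) = c a1 \<otimes> inv s"
      using ca a by (simp add: conj_c conjugate_mult cs)
    then show ?thesis by (simp add: s_def)
  qed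
  \<comment> \<open>The factors of \<open>e a1 a2\<close>: exchanging the indices permutes the first three and fixes the last.\<close>
  define u where "u a = conjugate a (inv b)" for a
  have uB: "u a \<in> B" if "a \<in> A" for a unfolding u_def using that A_carr b B_closed B_conj by simp
  define v where "v = conjugate (a1 \<otimes> a2) b"
  have vB: "v \<in> B" unfolding v_def using a1 a2 A_closed A_carr b B_conj by simp
  note ca = A_carr[OF a1] A_carr[OF a2] b_carr B_carr[OF uB[OF a1]] B_carr[OF uB[OF a2]] B_carr[OF vB]
     c_carr[OF a1] c_carr[OF a2]
  have e12: "e a1 a2 = u a1 \<otimes> b \<otimes> u a2 \<otimes> v"
    unfolding e_def c_def u_def v_def using ca
    by (simp add: inv_mult_group conjugate_mult conjugate_inv conjugate_conjugate m_assoc)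
  have e21: "e a2 a1 = u a2 \<otimes> b \<otimes> u a1 \<otimes> v"
    unfolding e_def c_def u_def v_def using ca A_comm[OF a1 a2]
    by (simp add: inv_mult_group conjugate_mult conjugate_inv conjugate_conjugate m_assoc)
  define t1 where "t1 = commutator b (u a2)"
  define t2 where "t2 = commutator (u a1) (b \<otimes> u a2)"
  have t1: "t1 \<in> B" "\<And>z. z \<in> B \<Longrightarrow> t1 \<otimes> z = z \<otimes> t1"
    unfolding t1_def using comm_in_B comm_central uB a2 b by simp_all
  have t2: "t2 \<in> B" "\<And>z. z \<in> B \<Longrightarrow> t2 \<otimes> z = z \<otimes> t2"
    unfolding t2_def using comm_in_B comm_central uB a1 a2 b B_closed by simp_all
  have tc: "t1 \<otimes> t2 \<otimes> z = z \<otimes> (t1 \<otimes> t2)" if z: "z \<in> B" for z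
  proof -
    have "t1 \<otimes> t2 \<otimes> z = t1 \<otimes> z \<otimes> t2"
      using t2(2)[OF z] B_carr[OF z] B_carr[OF t1(1)] B_carr[OF t2(1)] by (simp add: m_assoc)
    then show ?thesis
      using t1(2)[OF z] B_carr[OF z] B_carr[OF t1(1)] B_carr[OF t2(1)] by (simp add: m_assoc)
  qed
  note ca = ca B_carr[OF t1(1)] B_carr[OF t2(1)]
  have "u a1 \<otimes> b \<otimes> u a2 = u a1 \<otimes> (b \<otimes> u a2)" using ca by (simp add: m_assoc)
  also have "\<dots> = b \<otimes> u a2 \<otimes> u a1 \<otimes> t2"
    unfolding t2_def using ca by (intro mult_eq_mult_commutator) auto
  also have "b \<otimes> u a2 = u a2 \<otimes> b \<otimes> t1"
    unfolding t1_def using ca by (intro mult_eq_mult_commutator) auto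
  finally have "u a1 \<otimes> b \<otimes> u a2 = u a2 \<otimes> b \<otimes> (t1 \<otimes> u a1) \<otimes> t2" using ca by (simp add: m_assoc)
  then have "u a1 \<otimes> b \<otimes> u a2 = u a2 \<otimes> b \<otimes> u a1 \<otimes> (t1 \<otimes> t2)"
    using ca t1(2)[OF uB[OF a1]] by (simp add: m_assoc)
  then have "e a1 a2 = u a2 \<otimes> b \<otimes> u a1 \<otimes> (t1 \<otimes> t2 \<otimes> v)"
    unfolding e12 using ca by (simp add: m_assoc)
  also have "\<dots> = e a2 a1 \<otimes> (t1 \<otimes> t2)" unfolding tc[OF vB] e21 using ca by (simp add: m_assoc)
  finally have "commutator (e a1 a2) b = commutator (e a2 a1) b"
    using commutator_central_mult[OF eB[OF a2 a1] _ tc] t1(1) t2(1) B_closed by simp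
  then obtain r where r: "r = inv (commutator (e a1 a2) b)" "r = inv (commutator (e a2 a1) b)" by simp
  have rB: "r \<in> B" unfolding r(1) using eB[OF a1 a2] b comm_in_B B_closed by simp
  note ca = ca B_carr[OF rB]
  have s1: "c a1 \<otimes> c a2 = c a2 \<otimes> c a1 \<otimes> r"
  proof -
    have "c a1 \<otimes> c a2 = c a2 \<otimes> conjugate (c a2) (c a1)" using ca by (simp add: conjugate_def m_assoc)
    then show ?thesis using key[OF a1 a2] r(1) ca by (simp add: m_assoc)
  qed
  have s2: "c a2 \<otimes> c a1 = c a1 \<otimes> c a2 \<otimes> r"
  proof -
    have "c a2 \<otimes> c a1 = c a1 \<otimes> conjugate (c a1) (c a2)" using ca by (simp add: conjugate_def m_assoc)
    then show ?thesis using key[OF a2 a1] r(2) ca by (simp add: m_assoc)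
  qed
  have "c a1 \<otimes> c a2 = c a1 \<otimes> c a2 \<otimes> (r \<otimes> r)"
    using s1 s2 ca by (simp add: m_assoc)
  then have rr: "r [^] (2::nat) = \<one>" using ca by (simp add: numeral_2_eq_2 l_cancel_one')
  interpret B: finite_group "G\<lparr>carrier := B\<rparr>" using B_sub finite_group_subgroup by blast
  have "r [^] (p ^ k) = \<one>"
    using B.pow_order_eq_1[of r] rB B(2) by (simp add: order_def nat_pow_consistent[symmetric])
  moreover obtain j where "p ^ k = 2 * j + 1" using p(2) by (metis oddE even_power)
  ultimately have "r = \<one>" using rr ca by (simp add: nat_pow_pow[symmetric])
  then show ?thesis using s1 ca by simp
qed

definition M :: "'a set" where "M = generate G ((A \<inter> B) \<union> c ` A)"
definition C :: "'a set" where "C = {a \<in> A. \<forall>m\<in>M. a \<otimes> m = m \<otimes> a}"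

lemma gens_B: "(A \<inter> B) \<union> c ` A \<subseteq> B" using c_in_B by auto
lemma gens_carr: "(A \<inter> B) \<union> c ` A \<subseteq> carrier G" using gens_B B_carr by blast

lemma M_abelian: "abelian_subgroup M"
  unfolding M_def
proof (rule abelian_subgroup_generate[OF gens_carr])
  fix s t assume s: "s \<in> (A \<inter> B) \<union> c ` A" and t: "t \<in> (A \<inter> B) \<union> c ` A"
  show "s \<otimes> t = t \<otimes> s"
    using s t A_comm A_Int_B_commute_c c_commute by (elim UnE imageE IntE) simp_all
qed

lemma M_sub: "subgroup M G"
  using M_abelian by (auto simp: abelian_subgroup_def)
lemma M_B: "M \<subseteq> B" unfolding M_def by (rule generate_subgroup_incl[OF gens_B B_sub])
lemma M_carr: "x \<in> M \<Longrightarrow> x \<in> carrier G" using subgroup.mem_carrier[OF M_sub] .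
lemma c_M: "a \<in> A \<Longrightarrow> c a \<in> M" unfolding M_def by (rule generate.incl) simp
lemma A_Int_B_M: "A \<inter> B \<subseteq> M" unfolding M_def by (blast intro: generate.incl)

text \<open>The generators of \<open>M\<close> normalize \<open>A\<close>. The normalizer is written with \<open>x h x\<inverse>\<close>, which in a finite group
  defines the same subgroup as invariance under \<open>h \<mapsto> h\<^sup>x\<close>.\<close>
lemma M_norm:
  assumes "m \<in> M" "x \<in> A" shows "conjugate m x \<in> A"
proof -
  let ?N = "{x \<in> carrier G. \<forall>h\<in>A. x \<otimes> h \<otimes> inv x \<in> A}"
  have N: "subgroup ?N G" by (rule subgroup_normalizing[OF A_sub finite_subgroup[OF A_sub]])
  have "(A \<inter> B) \<union> c ` A \<subseteq> ?N"
  proof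
    fix s assume s: "s \<in> (A \<inter> B) \<union> c ` A"
    have "s \<otimes> h \<otimes> inv s \<in> A" if h: "h \<in> A" for h
      using s
    proof
      assume "s \<in> A \<inter> B"
      then show ?thesis using h A_closed by simp
    next
      assume "s \<in> c ` A"
      then obtain a where a: "a \<in> A" "s = c a" by auto
      show ?thesis using c_norm(2)[OF a(1) h] a c_carr[OF a(1)] by (simp add: conjugate_def)
    qed
    then show "s \<in> ?N" using s gens_carr by blast
  qed
  then have "M \<subseteq> ?N" unfolding M_def using N by (rule generate_subgroup_incl)
  then have "inv m \<otimes> x \<otimes> inv (inv m) \<in> A"
    using subgroup.m_inv_closed[OF M_sub assms(1)] assms(2) by blast
  then show ?thesis using M_carr[OF assms(1)] by (simp add: conjugate_def)
qed

lemma C_sub: "subgroup C G"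
proof -
  have "C = A \<inter> centralizer G M" using A_carr by (auto simp: C_def centralizer_def)
  moreover have "subgroup (centralizer G M) G"
    by (rule subgroup_centralizer) (use M_carr in blast)
  ultimately show ?thesis using subgroups_Inter_pair[OF A_sub] by simp
qed

lemma C_A: "C \<subseteq> A" by (auto simp: C_def)

lemma C_abelian: "abelian_subgroup C"
  unfolding abelian_subgroup_def using C_sub C_A A_comm by blast

lemma C_I:
  assumes "g \<in> A" "\<And>a. a \<in> A \<Longrightarrow> g \<otimes> c a = c a \<otimes> g"
  shows "g \<in> C"
proof -
  have "g \<otimes> m = m \<otimes> g" if m: "m \<in> M" for m
  proof (rule generate_commute[of "{g}" "(A \<inter> B) \<union> c ` A"])
    show "{g} \<subseteq> carrier G" using assms A_carr by simp
    show "s \<otimes> t = t \<otimes> s" if "s \<in> {g}" "t \<in> A \<inter> B \<union> c ` A" for s t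
      using that assms A_comm by auto
    show "g \<in> generate G {g}" by (rule generate.incl) simp
    show "m \<in> generate G (A \<inter> B \<union> c ` A)" using m by (simp add: M_def)
  qed (rule gens_carr)
  then show ?thesis using assms(1) by (simp add: C_def)
qed

text \<open>If \<open>[b, a]\<close> and \<open>[b, a\<^sub>0]\<close> agree modulo \<open>A \<inter> B\<close>, then \<open>g = a a\<^sub>0\<inverse>\<close> sends \<open>b\<close> to \<open>b z\<close> with
  \<open>z \<in> A \<inter> B\<close>. As \<open>g\<close> commutes with the elements of \<open>A\<close> and \<open>z\<close> centralizes \<open>M\<close>, it follows that \<open>g\<close>
  fixes all \<open>[b, a']\<close>.\<close>
lemma c_cong_mod_C:
  assumes a: "a \<in> A" and a0: "a0 \<in> A" and z: "z \<in> A" "z \<in> B" and eq: "c a = c a0 \<otimes> z"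
  shows "a \<otimes> inv a0 \<in> C"
proof -
  define g where "g = a \<otimes> inv a0"
  have gA: "g \<in> A" unfolding g_def using a a0 A_closed by simp
  note ca = A_carr[OF a] A_carr[OF a0] A_carr[OF z(1)] A_carr[OF gA] b_carr
  have "conjugate a b = conjugate a0 b \<otimes> z"
    using eq ca by (simp add: c_def m_assoc)
  then have "conjugate (inv a0) (conjugate a b) = b \<otimes> conjugate (inv a0) z"
    using ca by (simp add: conjugate_mult)
  then have gb: "conjugate g b = b \<otimes> z"
    using ca A_fix[OF z(1)] A_closed(2)[OF a0] by (simp add: g_def conjugate_conjugate)
  have "g \<otimes> c a' = c a' \<otimes> g" if a': "a' \<in> A" for a'
  proof -
    note ca = ca A_carr[OF a'] c_carr[OF a']
    have "conjugate g (conjugate a' b) = conjugate a' (conjugate g b)"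
      using ca A_comm[OF a' gA] by (simp add: conjugate_conjugate)
    also have "\<dots> = conjugate a' b \<otimes> z"
      unfolding gb using ca A_fix[OF z(1) a'] by (simp add: conjugate_mult)
    finally have "conjugate g (c a') = inv z \<otimes> (c a' \<otimes> z)"
      using ca gb by (simp add: c_def conjugate_mult conjugate_inv inv_mult_group m_assoc)
    also have "c a' \<otimes> z = z \<otimes> c a'" using A_Int_B_commute_c[OF z a'] by simp
    finally have "conjugate g (c a') = c a'" using ca by simp
    then show ?thesis using conjugate_fixed_iff ca by simp
  qed
  then show ?thesis using C_I[OF gA] by (simp add: g_def)
qed

text \<open>
  With \<open>K = M' \<inter> C\<^sub>E(M)\<close> the map \<open>a \<mapsto> [b, a] K\<close> from \<open>E\<close> to \<open>M'/K\<close> has fibres no larger than \<open>C\<^sub>E(M)\<close>, so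
  \<open>|E| |K| \<le> |C\<^sub>E(M)| |M'|\<close>. On the other hand \<open>|M'| |C\<^sub>E(M)| \<le> |M' C\<^sub>E(M)| |K|\<close>. The lemma is used with
  \<open>E = A\<close> and with \<open>E = \<Omega>(A)\<close>, to bound the order and the rank of the replacement.
\<close>
lemma card_le_replacement:
  assumes E: "subgroup E G" "E \<subseteq> A" and M': "subgroup M' G" "M' \<subseteq> M" and cE: "c ` E \<subseteq> M'"
  shows "card E \<le> card (M' <#> (C \<inter> E))"
proof -
  define CE where "CE = C \<inter> E"
  have CE: "subgroup CE G" unfolding CE_def using subgroups_Inter_pair[OF C_sub E(1)] .
  define K where "K = M' \<inter> CE"
  have K: "subgroup K G" unfolding K_def using subgroups_Inter_pair[OF M'(1) CE] .
  have KAB: "z \<in> A" "z \<in> B" if "z \<in> K" for z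
    using that C_A M'(2) M_B by (auto simp: K_def CE_def)
  note finE = finite_subgroup[OF E(1)] and finK = finite_subgroup[OF K] and finM = finite_subgroup[OF M'(1)] and finC = finite_subgroup[OF CE]
  note ccl = subgroup.mem_carrier[OF M'(1)] subgroup.mem_carrier[OF CE] subgroup.mem_carrier[OF K]
    subgroup.mem_carrier[OF E(1)]
  have "card (E \<times> K) \<le> card CE * card M'"
  proof (rule card_le_mult_fibre_bound[of _ _ "\<lambda>(a, z). c a \<otimes> z"])
    show "finite (E \<times> K)" "finite M'" using finE finK finM by simp_all
    show "(\<lambda>(a, z). c a \<otimes> z) \<in> E \<times> K \<rightarrow> M'"
      using cE subgroup.m_closed[OF M'(1)] by (auto simp: K_def)
    fix y
    let ?F = "{x \<in> E \<times> K. (case x of (a, z) \<Rightarrow> c a \<otimes> z) = y}"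
    show "card ?F \<le> card CE"
    proof (cases "?F = {}")
      case True then show ?thesis by (metis card.empty le0)
    next
      case False
      then obtain a0 z0 where a0: "a0 \<in> E" "z0 \<in> K" "c a0 \<otimes> z0 = y" by auto
      have "inj_on (\<lambda>(a, z). a \<otimes> inv a0) ?F"
      proof (rule inj_onI)
        fix x x' assume x: "x \<in> ?F" "x' \<in> ?F" and eq: "(case x of (a, z) \<Rightarrow> a \<otimes> inv a0) = (case x' of (a, z) \<Rightarrow> a \<otimes> inv a0)"
        obtain a z a' z' where xx: "x = (a, z)" "x' = (a', z')" by fastforce
        have az: "a \<in> E" "z \<in> K" "a' \<in> E" "z' \<in> K" "c a \<otimes> z = c a' \<otimes> z'" using x xx by auto
        have "a = a'" using eq xx az a0 ccl by simp
        moreover then have "z = z'" using az c_carr[of a] E(2) ccl(3) by auto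
        ultimately show "x = x'" using xx by simp
      qed
      moreover have "(\<lambda>(a, z). a \<otimes> inv a0) ` ?F \<subseteq> CE"
      proof clarify
        fix a z assume az: "a \<in> E" "z \<in> K" "y = c a \<otimes> z"
        have aA: "a \<in> A" "a0 \<in> A" using az a0 E(2) by auto
        note cc = c_carr[OF aA(1)] c_carr[OF aA(2)] ccl(3)[OF az(2)] ccl(3)[OF a0(2)]
        have "c a = (c a \<otimes> z) \<otimes> inv z" using cc by (simp add: m_assoc)
        also have "\<dots> = c a0 \<otimes> (z0 \<otimes> inv z)" using az(3) a0(3) cc by (simp add: m_assoc[symmetric])
        finally have "c a = c a0 \<otimes> (z0 \<otimes> inv z)" .
        moreover have "z0 \<otimes> inv z \<in> K"
          using subgroup.m_closed[OF K a0(2)] subgroup.m_inv_closed[OF K az(2)] by simp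
        ultimately have "a \<otimes> inv a0 \<in> C" using c_cong_mod_C[OF aA] KAB by blast
        moreover have "a \<otimes> inv a0 \<in> E"
          using subgroup.m_closed[OF E(1) az(1)] subgroup.m_inv_closed[OF E(1) a0(1)] by simp
        ultimately show "a \<otimes> inv a0 \<in> CE" by (simp add: CE_def)
      qed
      ultimately show ?thesis using card_inj_on_le[OF _ _ finC] by blast
    qed
  qed
  moreover have "card (M' \<times> CE) \<le> card K * card (M' <#> CE)"
  proof (rule card_le_mult_fibre_bound[of _ _ "\<lambda>(m, a). m \<otimes> a"])
    show "finite (M' \<times> CE)" using finM finC by simp
    show "finite (M' <#> CE)" using finM finC by (auto simp: set_mult_def)
    show "(\<lambda>(m, a). m \<otimes> a) \<in> M' \<times> CE \<rightarrow> M' <#> CE" by (auto simp: set_mult_def)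
    fix y
    let ?F = "{x \<in> M' \<times> CE. (case x of (m, a) \<Rightarrow> m \<otimes> a) = y}"
    show "card ?F \<le> card K"
    proof (cases "?F = {}")
      case True then show ?thesis by (metis card.empty le0)
    next
      case False
      then obtain m0 a0 where a0: "m0 \<in> M'" "a0 \<in> CE" "m0 \<otimes> a0 = y" by auto
      have key: "inv m0 \<otimes> m = a0 \<otimes> inv a" if "m \<in> M'" "a \<in> CE" "m \<otimes> a = y" for m a
      proof -
        note cc = ccl(1)[OF a0(1)] ccl(1)[OF that(1)] ccl(2)[OF a0(2)] ccl(2)[OF that(2)]
        have "m = (m \<otimes> a) \<otimes> inv a" using cc by (simp add: m_assoc)
        also have "m \<otimes> a = m0 \<otimes> a0" using that(3) a0(3) by simp
        finally have "inv m0 \<otimes> m = inv m0 \<otimes> (m0 \<otimes> a0 \<otimes> inv a)" by simp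
        then show ?thesis using cc by (simp add: m_assoc)
      qed
      have "inj_on (\<lambda>(m, a). inv m0 \<otimes> m) ?F"
      proof (rule inj_onI)
        fix x x' assume x: "x \<in> ?F" "x' \<in> ?F" and eq: "(case x of (m, a) \<Rightarrow> inv m0 \<otimes> m) = (case x' of (m, a) \<Rightarrow> inv m0 \<otimes> m)"
        obtain m a m' a' where xx: "x = (m, a)" "x' = (m', a')" by fastforce
        have az: "m \<in> M'" "a \<in> CE" "m' \<in> M'" "a' \<in> CE" "m \<otimes> a = m' \<otimes> a'" using x xx by auto
        have "m = m'" using eq xx az a0 ccl by simp
        moreover then have "a = a'" using az ccl by auto
        ultimately show "x = x'" using xx by simp
      qed
      moreover have "(\<lambda>(m, a). inv m0 \<otimes> m) ` ?F \<subseteq> K"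
      proof clarify
        fix m a assume ma: "m \<in> M'" "a \<in> CE" "y = m \<otimes> a"
        have "inv m0 \<otimes> m \<in> M'"
          using subgroup.m_closed[OF M'(1) subgroup.m_inv_closed[OF M'(1) a0(1)] ma(1)] .
        moreover have "a0 \<otimes> inv a \<in> CE"
          using subgroup.m_closed[OF CE a0(2) subgroup.m_inv_closed[OF CE ma(2)]] .
        ultimately show "inv m0 \<otimes> m \<in> K" using key[OF ma(1,2)] ma(3) by (simp add: K_def)
      qed
      ultimately show ?thesis using card_inj_on_le[OF _ _ finK] by blast
    qed
  qed
  ultimately have "card E * card K \<le> card (M' <#> CE) * card K"
    by (metis card_cartesian_product le_trans mult.commute)
  then show ?thesis using card_subgroup_pos[OF K] by (simp add: CE_def)
qed

text \<open>The element \<open>[b, a] a\<inverse> = (a\<inverse>)\<^sup>b\<close> has order dividing \<open>p\<close>, and so have \<open>a\<close> and the commutator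
  \<open>w\<close> of \<open>[b, a]\<close> and \<open>a\<inverse>\<close>. Since \<open>w \<in> A \<inter> B\<close> commutes with both, the power formula for class two applies.\<close>
lemma c_torsion:
  assumes a: "a \<in> A" and ap: "a [^] p = \<one>"
  shows "c a [^] p = \<one>"
proof -
  note ca = A_carr[OF a] b_carr c_carr[OF a]
  define u where "u = conjugate b (inv a)"
  have u: "u \<in> carrier G" "u [^] p = \<one>"
    unfolding u_def using ca ap by (simp_all add: conjugate_pow[symmetric] nat_pow_inv)
  have cu: "c a = u \<otimes> a" using c_alt[OF a] by (simp add: u_def)
  define z where "z = conjugate (c a) a"
  have zA: "z \<in> A" unfolding z_def using c_norm a by simp
  have zp: "z [^] p = \<one>" unfolding z_def using ca ap by (simp add: conjugate_pow[symmetric])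
  \<comment> \<open>\<open>w\<close> is the commutator of \<open>a\<inverse>\<close> and \<open>[b, a]\<close>\<close>
  define w where "w = a \<otimes> inv z"
  have wA: "w \<in> A" unfolding w_def using a zA A_closed by simp
  have wp: "w [^] p = \<one>"
    unfolding w_def using ca ap zp A_carr[OF zA] A_comm[OF a A_closed(2)[OF zA]]
    by (simp add: pow_mult_distrib nat_pow_inv)
  have "w = conjugate (inv a) (inv (c a)) \<otimes> c a"
    unfolding w_def z_def using ca by (simp add: conjugate_def m_assoc inv_mult_group)
  then have wB: "w \<in> B" using B_closed B_conj c_in_B[OF a] ca by simp
  note ca = ca A_carr[OF wA] A_carr[OF zA]
  have wc: "w \<otimes> c a = c a \<otimes> w" using A_Int_B_commute_c[OF wA wB a] .
  have "inv a \<otimes> c a = c a \<otimes> inv z"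
    unfolding z_def using ca by (simp add: conjugate_def m_assoc inv_mult_group)
  also have "inv z = inv a \<otimes> w" using ca by (simp add: w_def)
  finally have e: "inv a \<otimes> c a = c a \<otimes> inv a \<otimes> w" using ca by (simp add: m_assoc)
  have "(c a \<otimes> inv a) [^] p = c a [^] p \<otimes> inv a [^] p \<otimes> w [^] (p * (p - 1) div 2)"
    using ca e wc A_comm[OF wA A_closed(2)[OF a]] by (intro pow_mult_central_commutator) simp_all
  also have "p * (p - 1) div 2 = p * ((p - 1) div 2)" using p(2) by (simp add: div_mult_swap)
  also have "w [^] (p * ((p - 1) div 2)) = \<one>" using wp ca by (simp add: nat_pow_pow[symmetric])
  also have "inv a [^] p = \<one>" using ca ap by (simp add: nat_pow_inv)
  also have "c a \<otimes> inv a = u" unfolding cu using ca u(1) by (simp add: m_assoc)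
  finally show ?thesis using u(2) ca by simp
qed

text \<open>If \<open>M\<close> were contained in \<open>A\<close>, then \<open>[b, x] \<in> A\<close> for all \<open>x \<in> A\<close> and \<open>b\<close> would normalize \<open>A\<close>.
  So the intersection with \<open>B\<close> grows strictly.\<close>
theorem replacement_subgroup:
  assumes x: "x \<in> A" "conjugate b x \<notin> A" and X: "subgroup X G" "A \<subseteq> X" "B \<subseteq> X"
  obtains R where "abelian_subgroup R" "R \<subseteq> X"
    "A \<inter> B \<subset> R \<inter> B" "\<forall>r\<in>R. \<forall>a\<in>A. conjugate r a \<in> A"
    "card A \<le> card R" "card (torsion p A) \<le> card (torsion p R)"
    "torsion p A = A \<longrightarrow> torsion p R = R"
proof -
  define R where "R = M <#> C"
  have CM: "m \<otimes> k = k \<otimes> m" if "m \<in> M" "k \<in> C" for m k using that by (auto simp: C_def)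
  have R: "abelian_subgroup R"
    unfolding R_def using CM by (rule abelian_subgroup_set_mult[OF M_abelian C_abelian])
  have MR: "M \<subseteq> R"
    unfolding R_def set_mult_def using M_carr subgroup.one_closed[OF C_sub] by force
  have finR: "finite R" using R finite_subgroup by (auto simp: abelian_subgroup_def)
  have MA: "M \<noteq> A \<inter> B"
  proof
    assume "M = A \<inter> B"
    then have "c x \<in> A" using c_M[OF x(1)] by simp
    then have "c x \<otimes> inv x \<in> A" using x(1) A_closed by simp
    moreover have "c x \<otimes> inv x = inv (conjugate b x)"
      using x(1) A_carr[OF x(1)] b_carr by (simp add: c_alt m_assoc conjugate_inv)
    ultimately show False
      using x A_closed(2) A_carr[OF x(1)] b_carr by (metis conjugate_closed inv_inv)
  qed
  show ?thesis
  proof (rule that[OF R])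
    show "R \<subseteq> X"
      using subgroup.m_closed[OF X(1)] X M_B C_A unfolding R_def set_mult_def by blast
    show "A \<inter> B \<subset> R \<inter> B" using MA A_Int_B_M MR M_B by blast
    have "conjugate r a \<in> A" if r: "r \<in> R" and a: "a \<in> A" for r a
    proof -
      obtain m k where mk: "m \<in> M" "k \<in> C" "r = m \<otimes> k" using r by (auto simp: R_def set_mult_def)
      have kA: "k \<in> A" using mk C_A by auto
      have "conjugate r a = conjugate k (conjugate m a)"
        using mk M_carr A_carr kA a by (simp add: conjugate_conjugate)
      then show ?thesis using A_fix M_norm mk a kA by simp
    qed
    then show "\<forall>r\<in>R. \<forall>a\<in>A. conjugate r a \<in> A" by blast
    have "C \<inter> A = C" using C_A by blast
    then show "card A \<le> card R"
      using card_le_replacement[OF A_sub order_refl M_sub order_refl] c_M unfolding R_def by auto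
    have cT: "c ` torsion p A \<subseteq> torsion p M" using c_torsion c_M by (auto simp: torsion_def)
    have RP: "(m \<otimes> k) [^] p = \<one>" if "m \<in> M" "k \<in> C" "m [^] p = \<one>" "k [^] p = \<one>" for m k
    proof -
      have "k \<in> A" using that C_A by auto
      then show ?thesis using that CM M_carr A_carr by (simp add: pow_mult_distrib)
    qed
    have "torsion p M <#> (C \<inter> torsion p A) \<subseteq> torsion p R"
      unfolding R_def torsion_def set_mult_def using RP by auto
    then have "card (torsion p M <#> (C \<inter> torsion p A)) \<le> card (torsion p R)"
      using finR by (intro card_mono) (auto simp: torsion_def)
    moreover have "card (torsion p A) \<le> card (torsion p M <#> (C \<inter> torsion p A))"
      using subgroup_torsion[OF A] subgroup_torsion[OF M_abelian] cT
      by (intro card_le_replacement) (auto simp: torsion_def)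
    ultimately show "card (torsion p A) \<le> card (torsion p R)" by simp
    show "torsion p A = A \<longrightarrow> torsion p R = R"
    proof
      assume T: "torsion p A = A"
      have "A \<inter> B \<subseteq> torsion p M" using T A_Int_B_M by (auto simp: torsion_def)
      then have "M \<subseteq> torsion p M"
        unfolding M_def using subgroup_torsion[OF M_abelian] cT T
        by (intro generate_subgroup_incl) (auto simp: M_def)
      then have "m [^] p = \<one>" if "m \<in> M" for m using that by (auto simp: torsion_def)
      moreover have "a [^] p = \<one>" if "a \<in> C" for a using that T C_A by (auto simp: torsion_def)
      ultimately show "torsion p R = R"
        unfolding R_def torsion_def set_mult_def using RP by auto
    qed
  qed
qed

end

context finite_group begin

text \<open>
  Glauberman's replacement theorem, with control of the rank and the exponent of the new subgroup.
  An element \<open>b\<close> as in the construction exists because in the \<open>p\<close>-group \<open>B A\<close> the action of \<open>A\<close> on the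
  cosets of \<open>N(A)\<close> fixes a coset other than \<open>N(A)\<close>; its representative may be taken in \<open>B\<close>, since
  the factor from \<open>A\<close> does not affect the conjugate of \<open>A\<close>.
\<close>
theorem replacement_theorem:
  assumes p: "Factorial_Ring.prime p" "odd p"
    and P: "subgroup P G" "card P = p ^ n"
    and A: "abelian_subgroup A" "A \<subseteq> P"
    and B: "B \<lhd> G" "B \<subseteq> P"
    and comm: "\<And>x y. x \<in> B \<Longrightarrow> y \<in> B \<Longrightarrow> commutator x y \<in> A"
      "\<And>x y z. x \<in> B \<Longrightarrow> y \<in> B \<Longrightarrow> z \<in> B \<Longrightarrow> commutator x y \<otimes> z = z \<otimes> commutator x y"
    and X: "subgroup X G" "A \<subseteq> X" "B \<subseteq> X"
    and not_norm: "\<not> (\<forall>b\<in>B. \<forall>a\<in>A. conjugate b a \<in> A)"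
  obtains R where "abelian_subgroup R" "R \<subseteq> X"
    "A \<inter> B \<subset> R \<inter> B" "\<forall>r\<in>R. \<forall>a\<in>A. conjugate r a \<in> A"
    "card A \<le> card R" "card (torsion p A) \<le> card (torsion p R)"
    "torsion p A = A \<longrightarrow> torsion p R = R"
proof -
  have As: "subgroup A G" using A by (simp add: abelian_subgroup_def)
  have Bs: "subgroup B G" using B(1) normal_imp_subgroup by blast
  note Ac = subgroup.mem_carrier[OF As] and Bc = subgroup.mem_carrier[OF Bs]
  define Y where "Y = B <#> A"
  have Y: "subgroup Y G" unfolding Y_def by (rule mult_norm_subgroup[OF B(1) As])
  have AY: "A \<subseteq> Y" and BY: "B \<subseteq> Y"
    unfolding Y_def set_mult_def
    using subgroup.one_closed[OF As] subgroup.one_closed[OF Bs] Ac Bc by force+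
  have YP: "Y \<subseteq> P"
    unfolding Y_def set_mult_def using A(2) B(2) subgroup.m_closed[OF P(1)] by blast
  obtain k where k: "card Y = p ^ k"
    using card_subgroup_dvd[OF Y P(1) YP] P(2) divides_primepow_nat[OF p(1)] by metis
  obtain l where l: "card B = p ^ l"
    using card_subgroup_dvd[OF Bs P(1) B(2)] P(2) divides_primepow_nat[OF p(1)] by metis
  define N where "N = {x \<in> carrier G. \<forall>h\<in>A. x \<otimes> h \<otimes> inv x \<in> A}"
  have N: "subgroup N G" unfolding N_def by (rule subgroup_normalizing[OF As finite_subgroup[OF As]])
  have N': "conjugate x a \<in> A" if "x \<in> N" "a \<in> A" for x a
    using subgroup.m_inv_closed[OF N that(1)] that by (auto simp: N_def conjugate_def)
  have NI: "x \<in> N" if "x \<in> carrier G" "\<And>a. a \<in> A \<Longrightarrow> conjugate x a \<in> A" for x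
  proof -
    have "inv x \<in> N" using that by (auto simp: N_def conjugate_def)
    then show ?thesis using subgroup.m_inv_closed[OF N] that(1) by fastforce
  qed
  have AN: "A \<subseteq> N"
    unfolding N_def using Ac subgroup.m_closed[OF As] subgroup.m_inv_closed[OF As] by auto
  have "\<not> Y \<subseteq> N" using not_norm N' BY by blast
  then have ne: "Y \<inter> N \<noteq> Y" by blast
  have AYN: "A \<subseteq> Y \<inter> N" using AY AN by blast
  obtain x where x: "x \<in> Y" "x \<notin> Y \<inter> N" "\<And>q. q \<in> A \<Longrightarrow> x \<otimes> q \<otimes> inv x \<in> Y \<inter> N"
    using p_group_exists_conj_into_outside[OF p(1) Y k subgroups_Inter_pair[OF Y N] _ ne As AYN] by blast
  obtain b0 a0 where ba: "b0 \<in> B" "a0 \<in> A" "x = b0 \<otimes> a0" using x(1) by (auto simp: Y_def set_mult_def)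
  note ca = Bc[OF ba(1)] Ac[OF ba(2)]
  define b where "b = inv b0"
  have bB: "b \<in> B" unfolding b_def using ba(1) subgroup.m_inv_closed[OF Bs] by simp
  have conj_b: "conjugate b a \<in> N" if a: "a \<in> A" for a
  proof -
    have "x \<otimes> (inv a0 \<otimes> a \<otimes> a0) \<otimes> inv x \<in> N"
      using x(3) a ba(2) subgroup.m_closed[OF As] subgroup.m_inv_closed[OF As] by simp
    moreover have "x \<otimes> (inv a0 \<otimes> a \<otimes> a0) \<otimes> inv x = conjugate b a"
      using ca Ac[OF a] by (simp add: b_def ba(3) conjugate_def m_assoc inv_mult_group)
    ultimately show ?thesis by simp
  qed
  have "b \<notin> N"
  proof
    assume "b \<in> N"
    then have "b0 \<in> N" using subgroup.m_inv_closed[OF N] ca by (force simp: b_def)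
    then have "x \<in> N" using ba AN subgroup.m_closed[OF N] by blast
    with x show False by blast
  qed
  then obtain y where y: "y \<in> A" "conjugate b y \<notin> A" using NI Bc[OF bB] by blast
  interpret R: replacement G p l A B b
    by (intro replacement.intro replacement_axioms.intro finite_group_axioms)
      (fact p A(1) B(1) l comm bB N'[OF conj_b])+
  show ?thesis
    using R.replacement_subgroup[OF y X] that by blast
qed

end

section \<open>The rank of an abelian \<open>p\<close>-group\<close>

context finite_group begin

lemma subgroup_pow_image:
  assumes "abelian_subgroup A"
  shows "subgroup ((\<lambda>x. x [^] (n::nat)) ` A) G"
proof (rule subgroupI)
  have A: "subgroup A G" "\<And>x y. x \<in> A \<Longrightarrow> y \<in> A \<Longrightarrow> x \<otimes> y = y \<otimes> x"
    using assms by (auto simp: abelian_subgroup_def)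
  note Ac = subgroup.mem_carrier[OF A(1)]
  show "(\<lambda>x. x [^] n) ` A \<subseteq> carrier G" using Ac by auto
  show "(\<lambda>x. x [^] n) ` A \<noteq> {}" using subgroup.one_closed[OF A(1)] by auto
  show "inv x \<in> (\<lambda>x. x [^] n) ` A" if "x \<in> (\<lambda>x. x [^] n) ` A" for x
    using that Ac subgroup.m_inv_closed[OF A(1)] by (auto simp: nat_pow_inv[symmetric])
  fix x y assume "x \<in> (\<lambda>x. x [^] n) ` A" "y \<in> (\<lambda>x. x [^] n) ` A"
  then obtain a b where ab: "a \<in> A" "b \<in> A" "x = a [^] n" "y = b [^] n" by auto
  have "x \<otimes> y = (a \<otimes> b) [^] n" using ab Ac A(2) by (simp add: pow_mult_distrib)
  then show "x \<otimes> y \<in> (\<lambda>x. x [^] n) ` A" using subgroup.m_closed[OF A(1) ab(1,2)] by blast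
qed

text \<open>The two factors are the orders of the kernel and the image of \<open>x \<mapsto> x\<^sup>n\<close>.\<close>
lemma card_torsion_mult_card_pow_image:
  assumes "abelian_subgroup A"
  shows "card (torsion n A) * card ((\<lambda>x. x [^] n) ` A) = card A"
proof (rule antisym)
  have A: "subgroup A G" "\<And>x y. x \<in> A \<Longrightarrow> y \<in> A \<Longrightarrow> x \<otimes> y = y \<otimes> x"
    using assms by (auto simp: abelian_subgroup_def)
  note Ac = subgroup.mem_carrier[OF A(1)]
  define F where "F = (\<lambda>x. x [^] n) ` A"
  have fA: "finite A" using finite_subgroup[OF A(1)] .
  have fT: "finite (torsion n A)" using fA by (simp add: torsion_def)
  have fF: "finite F" using fA by (simp add: F_def)
  have "card A \<le> card (torsion n A) * card F"
  proof (rule card_le_mult_fibre_bound[OF fA fF])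
    show "(\<lambda>x. x [^] n) \<in> A \<rightarrow> F" by (auto simp: F_def)
    fix y assume "y \<in> F"
    then obtain x0 where x0: "x0 \<in> A" "y = x0 [^] n" by (auto simp: F_def)
    have "inj_on (\<lambda>x. x \<otimes> inv x0) {x \<in> A. x [^] n = y}"
      using Ac x0 by (auto intro!: inj_onI)
    moreover have "(\<lambda>x. x \<otimes> inv x0) ` {x \<in> A. x [^] n = y} \<subseteq> torsion n A"
    proof clarify
      fix x assume x: "x \<in> A" "y = x [^] n"
      have i: "inv x0 \<in> A" using subgroup.m_inv_closed[OF A(1) x0(1)] .
      have "(x \<otimes> inv x0) [^] n = x [^] n \<otimes> inv (x0 [^] n)"
        using pow_mult_distrib[OF A(2)[OF x(1) i]] x(1) x0(1) Ac by (simp add: nat_pow_inv)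
      also have "\<dots> = \<one>" using x x0 Ac by (metis nat_pow_closed r_inv)
      finally show "x \<otimes> inv x0 \<in> torsion n A"
        using subgroup.m_closed[OF A(1) x(1) i] by (simp add: torsion_def)
    qed
    ultimately show "card {x \<in> A. x [^] n = y} \<le> card (torsion n A)"
      using card_inj_on_le[OF _ _ fT] by blast
  qed
  then show "card A \<le> card (torsion n A) * card ((\<lambda>x. x [^] n) ` A)" by (simp add: F_def)
  define r where "r y = (SOME x. x \<in> A \<and> x [^] n = y)" for y
  have r: "r y \<in> A" "r y [^] n = y" if "y \<in> F" for y
  proof -
    have "\<exists>x. x \<in> A \<and> x [^] n = y" using that by (auto simp: F_def)
    then have "r y \<in> A \<and> r y [^] n = y" unfolding r_def by (rule someI_ex)
    then show "r y \<in> A" "r y [^] n = y" by auto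
  qed
  have pw: "(r y \<otimes> w) [^] n = y" if "y \<in> F" "w \<in> torsion n A" for y w
    using r[OF that(1)] that Ac A(2) by (auto simp: torsion_def pow_mult_distrib F_def)
  have "inj_on (\<lambda>(w, y). r y \<otimes> w) (torsion n A \<times> F)"
  proof (rule inj_onI, clarify)
    fix w y w' y' assume w: "w \<in> torsion n A" "w' \<in> torsion n A" and y: "y \<in> F" "y' \<in> F"
      and eq: "r y \<otimes> w = r y' \<otimes> w'"
    have "y = y'" using pw[OF y(1) w(1)] pw[OF y(2) w(2)] eq by simp
    moreover have "w = w'" using eq r(1)[OF y(1)] w Ac unfolding \<open>y = y'\<close>[symmetric]
      by (simp add: torsion_def)
    ultimately show "w = w' \<and> y = y'" by simp
  qed
  moreover have "(\<lambda>(w, y). r y \<otimes> w) ` (torsion n A \<times> F) \<subseteq> A"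
    using r(1) subgroup.m_closed[OF A(1)] by (auto simp: torsion_def)
  ultimately have "card (torsion n A \<times> F) \<le> card A" using card_inj_on_le[OF _ _ fA] by blast
  then show "card (torsion n A) * card ((\<lambda>x. x [^] n) ` A) \<le> card A"
    by (simp add: card_cartesian_product F_def)
qed

lemma card_generate_insert_le:
  assumes A: "abelian_subgroup A" and H: "subgroup H G" "H \<subseteq> A"
    and t: "t \<in> A" "t [^] q \<in> H" and q: "q > (0::nat)"
  shows "card (generate G (insert t H)) \<le> q * card H"
proof -
  have As: "subgroup A G" "\<And>x y. x \<in> A \<Longrightarrow> y \<in> A \<Longrightarrow> x \<otimes> y = y \<otimes> x"
    using A by (auto simp: abelian_subgroup_def)
  note Ac = subgroup.mem_carrier[OF As(1)] and Hc = subgroup.mem_carrier[OF H(1)]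
  have tn: "t [^] (i::nat) \<in> A" for i by (induction i) (use subgroup.one_closed[OF As(1)] subgroup.m_closed[OF As(1)] t in auto)
  have tqH: "(t [^] q) [^] (i::nat) \<in> H" for i
    by (induction i) (use subgroup.one_closed[OF H(1)] subgroup.m_closed[OF H(1)] t in auto)
  define K where "K = {h \<otimes> t [^] i |h i. h \<in> H \<and> i < q}"
  have K_image: "K = (\<lambda>(h, i). h \<otimes> t [^] i) ` (H \<times> {..<q})" unfolding K_def by auto
  have KI: "h \<otimes> t [^] i \<in> K" if h: "h \<in> H" for h and i :: nat
  proof -
    have "t [^] i = (t [^] q) [^] (i div q) \<otimes> t [^] (i mod q)"
      using Ac[OF t(1)] by (simp add: nat_pow_pow nat_pow_mult)
    then have "h \<otimes> t [^] i = (h \<otimes> (t [^] q) [^] (i div q)) \<otimes> t [^] (i mod q)"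
      using Hc[OF h] Ac[OF t(1)] by (simp add: m_assoc)
    moreover have "h \<otimes> (t [^] q) [^] (i div q) \<in> H" using subgroup.m_closed[OF H(1) h tqH] .
    ultimately show ?thesis unfolding K_def using q by force
  qed
  have sw: "(h \<otimes> t [^] i) \<otimes> (h' \<otimes> t [^] j) = (h \<otimes> h') \<otimes> t [^] (i + j)"
    if "h \<in> H" "h' \<in> H" for h h' and i j :: nat
  proof -
    have "(h \<otimes> t [^] i) \<otimes> (h' \<otimes> t [^] j) = h \<otimes> (t [^] i \<otimes> h') \<otimes> t [^] j"
      using that Hc Ac[OF tn] by (simp add: m_assoc)
    also have "t [^] i \<otimes> h' = h' \<otimes> t [^] i" using As(2)[OF tn] that H(2) by blast
    finally show ?thesis using that Hc Ac[OF t(1)] by (simp add: m_assoc nat_pow_mult[symmetric])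
  qed
  have "subgroup K G"
  proof (rule subgroupI)
    show "K \<subseteq> carrier G" using Hc Ac[OF tn] by (auto simp: K_def)
    show "K \<noteq> {}" using KI[OF subgroup.one_closed[OF H(1)]] by blast
    fix x assume "x \<in> K"
    then obtain h and i :: nat where x: "h \<in> H" "x = h \<otimes> t [^] i" unfolding K_def by blast
    fix y assume "y \<in> K"
    then obtain h' and j :: nat where y: "h' \<in> H" "y = h' \<otimes> t [^] j" unfolding K_def by blast
    show "x \<otimes> y \<in> K" unfolding x(2) y(2) sw[OF x(1) y(1)] by (rule KI[OF subgroup.m_closed[OF H(1) x(1) y(1)]])
  next
    fix x assume "x \<in> K"
    then obtain h and i :: nat where x: "h \<in> H" "x = h \<otimes> t [^] i" unfolding K_def by blast
    let ?h = "inv h \<otimes> inv ((t [^] q) [^] i)"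
    have h: "?h \<in> H" using subgroup.m_closed[OF H(1)] subgroup.m_inv_closed[OF H(1)] x(1) tqH by simp
    \<comment> \<open>An inverse power of \<open>t\<close> is an element of \<open>H\<close>, an inverse power of \<open>t\<^sup>q\<close>, times a natural power of \<open>t\<close>.\<close>
    have e: "i + (q - 1) * i = q * i" using q by (cases q) auto
    have "x \<otimes> (?h \<otimes> t [^] ((q - 1) * i)) = (h \<otimes> ?h) \<otimes> t [^] (q * i)"
      unfolding x(2) sw[OF x(1) h] e ..
    also have "\<dots> = \<one>" using Hc[OF x(1)] Ac[OF t(1)] by (simp add: nat_pow_pow m_assoc)
    finally have "inv x = ?h \<otimes> t [^] ((q - 1) * i)"
      using Hc[OF x(1)] Hc[OF h] Ac[OF t(1)] x(2) by (metis inv_equality inv_inv inv_unique' m_closed nat_pow_closed inv_comm)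
    then show "inv x \<in> K" using KI[OF h] by simp
  qed
  moreover have "insert t H \<subseteq> K"
  proof -
    have "\<one> \<otimes> t [^] (1::nat) \<in> K" using KI[OF subgroup.one_closed[OF H(1)]] .
    moreover have "h \<in> K" if "h \<in> H" for h using KI[OF that, of 0] Hc[OF that] by simp
    ultimately show ?thesis using Ac[OF t(1)] by auto
  qed
  ultimately have "generate G (insert t H) \<subseteq> K" by (intro generate_subgroup_incl)
  moreover have fH: "finite (H \<times> {..<q})" using finite_subgroup[OF H(1)] by simp
  ultimately have "card (generate G (insert t H)) \<le> card K" unfolding K_image by (intro card_mono) auto
  also have "\<dots> \<le> card (H \<times> {..<q})" unfolding K_image by (rule card_image_le[OF fH])
  finally show ?thesis by (simp add: card_cartesian_product mult.commute)
qed

text \<open>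
  Let \<open>F\<close> be the image of \<open>x \<mapsto> x\<^sup>p\<close>, so that \<open>|\<Omega>(A)| = |A : F|\<close>. A generator added to a subgroup containing
  \<open>F\<close> multiplies the order by at most \<open>p\<close>, hence \<open>|A : F| \<le> p\<^sup>r\<close> for \<open>r\<close> generators. Conversely, a largest
  set whose elements, added one after the other, each multiply the order by at least \<open>p\<close> generates
  \<open>A\<close> together with \<open>F\<close>, and then generates \<open>A\<close> alone, by a Nakayama argument.
\<close>
lemma card_torsion_eq_prime_pow_rank:
  assumes p: "Factorial_Ring.prime p" and A: "abelian_subgroup A" "card A = p ^ n"
  shows "card (torsion p A) = p ^ subgroup_rank G A"
proof -
  have As: "subgroup A G" "\<And>x y. x \<in> A \<Longrightarrow> y \<in> A \<Longrightarrow> x \<otimes> y = y \<otimes> x"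
    using A by (auto simp: abelian_subgroup_def)
  note Ac = subgroup.mem_carrier[OF As(1)]
  have Asub: "A \<subseteq> carrier G" using Ac by blast
  have fA: "finite A" using finite_subgroup[OF As(1)] .
  define F where "F = (\<lambda>x. x [^] p) ` A"
  have F: "subgroup F G" unfolding F_def by (rule subgroup_pow_image[OF A(1)])
  have powA: "x [^] (i::nat) \<in> A" if "x \<in> A" for x i
    by (induction i) (use subgroup.one_closed[OF As(1)] subgroup.m_closed[OF As(1)] that in auto)
  have FA: "F \<subseteq> A" using powA by (auto simp: F_def)
  have cF: "card (torsion p A) * card F = card A"
    unfolding F_def by (rule card_torsion_mult_card_pow_image[OF A(1)])
  have Fpos: "card F > 0" using card_subgroup_pos[OF F] .
  have genA: "generate G (S \<union> F) \<subseteq> A" if "S \<subseteq> A" for S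
    using that FA by (intro generate_subgroup_incl[OF _ As(1)]) auto
  have genS: "subgroup (generate G (S \<union> F)) G" if "S \<subseteq> A" for S
    using that FA Asub by (intro generate_is_subgroup) auto
  have upper: "card (generate G (S \<union> F)) \<le> p ^ card S * card F" if "finite S" "S \<subseteq> A" for S
    using that
  proof (induction S)
    case empty
    have "generate G F = F" using generate_subgroup_incl[OF order_refl F] by (auto intro: generate.incl)
    then show ?case by simp
  next
    case (insert t S)
    let ?H = "generate G (S \<union> F)"
    have S: "S \<subseteq> A" using insert by auto
    have "insert t S \<union> F \<subseteq> insert t ?H" by (auto intro: generate.incl)
    then have "generate G (insert t S \<union> F) \<subseteq> generate G (insert t ?H)" by (rule mono_generate)
    moreover have "insert t ?H \<subseteq> carrier G" using genA[OF S] insert Asub by auto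
    then have "finite (generate G (insert t ?H))" using finite_subgroup generate_is_subgroup by blast
    ultimately have "card (generate G (insert t S \<union> F)) \<le> card (generate G (insert t ?H))"
      by (intro card_mono)
    also have "\<dots> \<le> p * card ?H"
    proof (rule card_generate_insert_le[OF A(1) genS[OF S] genA[OF S]])
      show "t \<in> A" using insert by auto
      then have "t [^] p \<in> F" by (auto simp: F_def)
      then show "t [^] p \<in> ?H" by (auto intro: generate.incl)
      show "p > 0" using prime_gt_0_nat[OF p] .
    qed
    also have "\<dots> \<le> p * (p ^ card S * card F)" using insert.IH[OF S] by simp
    finally show ?case using insert by (simp add: mult.assoc)
  qed
  have rank_lower: "card (torsion p A) \<le> p ^ card S" if S: "finite S" "S \<subseteq> A" "generate G S = A" for S
  proof -
    have "A \<subseteq> generate G (S \<union> F)" using S(3) mono_generate[of S "S \<union> F"] by auto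
    then have "generate G (S \<union> F) = A" using genA[OF S(2)] by simp
    then have "card (torsion p A) * card F \<le> p ^ card S * card F"
      using upper[OF S(1,2)] cF by simp
    then show ?thesis using Fpos by simp
  qed
  have nakayama: "generate G S = A" if S: "S \<subseteq> A" "generate G (S \<union> F) = A" for S
  proof
    let ?H = "generate G S"
    show HA: "?H \<subseteq> A" using S(1) by (intro generate_subgroup_incl[OF _ As(1)])
    have H: "subgroup ?H G" using S(1) Asub by (intro generate_is_subgroup) auto
    have Hab: "abelian_subgroup ?H" using H HA As(2) by (auto simp: abelian_subgroup_def)
    have Fab: "abelian_subgroup F" using F FA As(2) by (auto simp: abelian_subgroup_def)
    have HF: "subgroup (?H <#> F) G"
      using abelian_subgroup_set_mult[OF Hab Fab] As(2) HA FA by (auto simp: abelian_subgroup_def)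
    have "S \<union> F \<subseteq> ?H <#> F"
    proof
      fix x assume "x \<in> S \<union> F"
      then show "x \<in> ?H <#> F"
      proof
        assume "x \<in> S"
        then have "x = x \<otimes> \<one>" "x \<in> ?H" "\<one> \<in> F"
          using Ac S(1) subgroup.one_closed[OF F] by (auto intro: generate.incl)
        then show ?thesis unfolding set_mult_def by blast
      next
        assume "x \<in> F"
        then have "x = \<one> \<otimes> x" "\<one> \<in> ?H" using Ac FA by (auto intro: generate.one)
        then show ?thesis unfolding set_mult_def using \<open>x \<in> F\<close> by blast
      qed
    qed
    then have AHF: "A \<subseteq> ?H <#> F" using generate_subgroup_incl[OF _ HF] S(2) by blast
    \<comment> \<open>Substitute \<open>A = H F\<close> into itself \<open>k\<close> times; for \<open>k = n\<close> the second factor is trivial.\<close>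
    have dec: "\<exists>h\<in>?H. \<exists>y\<in>A. x = h \<otimes> y [^] (p ^ k)" if "x \<in> A" for x k
    proof (induction k)
      case 0
      have "x = \<one> \<otimes> x [^] (p ^ 0)" using Ac[OF that] by simp
      then show ?case using that generate.one by blast
    next
      case (Suc k)
      then obtain h y where hy: "h \<in> ?H" "y \<in> A" "x = h \<otimes> y [^] (p ^ k)" by blast
      obtain h' z where hz: "h' \<in> ?H" "z \<in> A" "y = h' \<otimes> z [^] p"
        using AHF hy(2) by (auto simp: set_mult_def F_def)
      have h'A: "h' \<in> A" using hz HA by blast
      have "y [^] (p ^ k) = h' [^] (p ^ k) \<otimes> (z [^] p) [^] (p ^ k)"
        unfolding hz(3) using Ac[OF h'A] Ac[OF hz(2)]
        by (intro pow_mult_distrib[OF As(2)[OF h'A powA[OF hz(2)]]]) simp_all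
      then have "x = (h \<otimes> h' [^] (p ^ k)) \<otimes> z [^] (p ^ Suc k)"
        using hy Ac[OF h'A] Ac[OF hz(2)] HA Ac by (auto simp: m_assoc nat_pow_pow)
      moreover have "h' [^] (i::nat) \<in> ?H" for i
        by (induction i) (use subgroup.one_closed[OF H] subgroup.m_closed[OF H] hz(1) in auto)
      then have "h \<otimes> h' [^] (p ^ k) \<in> ?H" using subgroup.m_closed[OF H hy(1)] by simp
      ultimately show ?case using hz(2) by blast
    qed
    show "A \<subseteq> ?H"
    proof
      fix x assume x: "x \<in> A"
      obtain h y where hy: "h \<in> ?H" "y \<in> A" "x = h \<otimes> y [^] (p ^ n)" using dec[OF x] by blast
      interpret A: finite_group "G\<lparr>carrier := A\<rparr>" using finite_group_subgroup[OF As(1)] .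
      have "y [^] (p ^ n) = \<one>"
        using A.pow_order_eq_1[of y] hy(2) A(2) by (simp add: order_def nat_pow_consistent[symmetric])
      then show "x \<in> ?H" using hy HA Ac by auto
    qed
  qed
  \<comment> \<open>Sets whose elements are independent modulo \<open>F\<close>\<close>
  define \<S> where "\<S> = {S. S \<subseteq> A \<and> p ^ card S * card F \<le> card (generate G (S \<union> F))}"
  have "{} \<in> \<S>"
    using genS[of "{}"] finite_subgroup by (auto simp: \<S>_def intro!: card_mono generate.incl)
  moreover have "finite \<S>" using fA by (simp add: \<S>_def)
  ultimately obtain S where S: "S \<in> \<S>" and mx: "\<And>T. T \<in> \<S> \<Longrightarrow> card T \<le> card S"
    using obtains_MAX[of \<S> card] by (metis Max_ge empty_iff finite_imageI imageI)
  have SA: "S \<subseteq> A" using S by (simp add: \<S>_def)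
  have fS: "finite S" using SA fA finite_subset by blast
  have "generate G (S \<union> F) = A"
  proof (rule ccontr)
    assume ne: "generate G (S \<union> F) \<noteq> A"
    then obtain t where t: "t \<in> A" "t \<notin> generate G (S \<union> F)" using genA[OF SA] by blast
    have tS: "t \<notin> S" using t(2) by (auto intro: generate.incl)
    have iS: "insert t S \<subseteq> A" using t SA by simp
    let ?H = "generate G (S \<union> F)" and ?K = "generate G (insert t S \<union> F)"
    have HK: "?H \<subseteq> ?K" by (rule mono_generate) auto
    have "t \<in> ?K" by (rule generate.incl) simp
    then have "?H \<subset> ?K" using t HK by blast
    then have lt: "card ?H < card ?K" using finite_subgroup[OF genS[OF iS]] psubset_card_mono by blast
    obtain i where i: "card ?H = p ^ i"
      using card_subgroup_dvd[OF genS[OF SA] As(1) genA[OF SA]] A(2) divides_primepow_nat[OF p] by metis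
    obtain j where j: "card ?K = p ^ j"
      using card_subgroup_dvd[OF genS[OF iS] As(1) genA[OF iS]] A(2) divides_primepow_nat[OF p] by metis
    have "i < j" using lt i j prime_gt_1_nat[OF p] by (simp add: power_strict_increasing_iff)
    then have "p ^ Suc i \<le> p ^ j" using prime_gt_0_nat[OF p] by (intro power_increasing) auto
    then have "p * card ?H \<le> card ?K" using i j by simp
    moreover have "p * (p ^ card S * card F) \<le> p * card ?H" using S by (simp add: \<S>_def)
    ultimately have "p * (p ^ card S * card F) \<le> card ?K" by (rule order_trans[rotated])
    then have "p ^ card (insert t S) * card F \<le> card ?K"
      using tS fS by (simp add: mult.assoc)
    then have "insert t S \<in> \<S>" using iS by (simp add: \<S>_def)
    then have "card (insert t S) \<le> card S" by (rule mx)
    then show False using tS fS by simp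
  qed
  moreover then have gS: "generate G S = A" by (rule nakayama[OF SA])
  ultimately have "p ^ card S * card F \<le> card (torsion p A) * card F" using S cF by (simp add: \<S>_def)
  then have up: "p ^ card S \<le> card (torsion p A)" using Fpos by simp
  let ?Q = "\<lambda>m. \<exists>S. S \<subseteq> A \<and> finite S \<and> card S = m \<and> generate G S = A"
  have Q: "?Q (card S)" using SA fS gS by blast
  then have "?Q (subgroup_rank G A)" unfolding subgroup_rank_def by (rule LeastI)
  then obtain T where T: "T \<subseteq> A" "finite T" "card T = subgroup_rank G A" "generate G T = A" by (elim exE conjE)
  have "card (torsion p A) \<le> p ^ subgroup_rank G A" using rank_lower[OF T(2,1,4)] unfolding T(3) .
  moreover have "subgroup_rank G A \<le> card S" unfolding subgroup_rank_def using Q by (rule Least_le)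
  then have "p ^ subgroup_rank G A \<le> p ^ card S" using prime_gt_0_nat[OF p] by (intro power_increasing) auto
  ultimately show ?thesis using up by simp
qed

end

section \<open>\<open>p\<close>-stability, Sylow subgroups and the Frattini argument\<close>

context finite_group begin

lemma normal_conjugate: "N \<lhd> G \<Longrightarrow> g \<in> carrier G \<Longrightarrow> x \<in> N \<Longrightarrow> conjugate g x \<in> N"
  unfolding conjugate_def using normal.inv_op_closed1 by fast

lemma normalI_conjugate:
  assumes "subgroup N G" "\<And>g x. g \<in> carrier G \<Longrightarrow> x \<in> N \<Longrightarrow> conjugate g x \<in> N"
  shows "N \<lhd> G"
proof (rule normal_invI[OF assms(1)])
  fix x h assume "x \<in> carrier G" "h \<in> N"
  then show "x \<otimes> h \<otimes> inv x \<in> N" using assms(2)[of "inv x" h] by (simp add: conjugate_def)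
qed

lemma normal_centralizer:
  assumes "B \<lhd> G" shows "centralizer G B \<lhd> G"
proof (rule normalI_conjugate)
  have Bc: "x \<in> carrier G" if "x \<in> B" for x
    using subgroup.mem_carrier[OF normal_imp_subgroup[OF assms] that] .
  show "subgroup (centralizer G B) G" using Bc by (intro subgroup_centralizer) blast
  fix g x assume g: "g \<in> carrier G" and x: "x \<in> centralizer G B"
  have xc: "x \<in> carrier G" using x by (simp add: centralizer_def)
  have "conjugate g x \<otimes> s = s \<otimes> conjugate g x" if s: "s \<in> B" for s
  proof -
    have "conjugate (inv g) s \<in> B" using normal_conjugate[OF assms _ s] g by simp
    then have "x \<otimes> conjugate (inv g) s = conjugate (inv g) s \<otimes> x" using x by (simp add: centralizer_def)
    then have "conjugate g (x \<otimes> conjugate (inv g) s) = conjugate g (conjugate (inv g) s \<otimes> x)" by simp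
    then show ?thesis using g xc Bc[OF s] by (simp add: conjugate_mult)
  qed
  then show "conjugate g x \<in> centralizer G B" using g xc by (simp add: centralizer_def)
qed

lemma normalizer_normal:
  assumes "B \<lhd> G" shows "normalizer G B = carrier G"
proof
  show "normalizer G B \<subseteq> carrier G" by (auto simp: normalizer_def stabilizer_def)
  have "subgroup (carrier G) (G\<lparr>carrier := normalizer G B\<rparr>)"
    using normal_imp_subgroup_normalizer[OF subgroup_self] assms by simp
  then show "carrier G \<subseteq> normalizer G B" using subgroup.subset by fastforce
qed

text \<open>
  This is the form in which \<open>p\<close>-stability is applied. If \<open>B\<close> normalizes the abelian subgroup \<open>A\<close>, then
  \<open>[B, g] \<le> A\<close> and \<open>[B, g, g] = 1\<close> for \<open>g \<in> A\<close>. The quotient by \<open>C\<^sub>G(B)\<close> disappears from the conclusion: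
  to place \<open>g\<close> in \<open>M\<close> it is enough that \<open>M\<close> contains the preimage of each normal \<open>p\<close>-subgroup of
  \<open>G/C\<^sub>G(B)\<close>.
\<close>
lemma p_stable_mem:
  assumes stab: "p_stable p G" and B: "B \<lhd> G" "card B = p ^ n"
    and A: "abelian_subgroup A" "\<And>x a. x \<in> B \<Longrightarrow> a \<in> A \<Longrightarrow> conjugate x a \<in> A"
    and M: "subgroup M G"
      "\<And>K k. K \<lhd> G \<Longrightarrow> centralizer G B \<subseteq> K \<Longrightarrow> card K = card (centralizer G B) * p ^ k \<Longrightarrow> K \<subseteq> M"
    and g: "g \<in> A"
  shows "g \<in> M"
proof -
  have As: "subgroup A G" "\<And>x y. x \<in> A \<Longrightarrow> y \<in> A \<Longrightarrow> x \<otimes> y = y \<otimes> x"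
    using A by (auto simp: abelian_subgroup_def)
  note Ac = subgroup.mem_carrier[OF As(1)]
  have Bs: "subgroup B G" using normal_imp_subgroup[OF B(1)] .
  note Bc = subgroup.mem_carrier[OF Bs]
  define C where "C = centralizer G B"
  have C: "C \<lhd> G" unfolding C_def by (rule normal_centralizer[OF B(1)])
  interpret C: normal C G by (rule C)
  have CM: "C \<subseteq> M" using M(2)[OF C, of 0] by (simp add: C_def)
  have "(\<lambda>x. inv x \<otimes> inv g \<otimes> x \<otimes> g) ` B \<subseteq> A"
  proof clarify
    fix x assume x: "x \<in> B"
    have "conjugate x (inv g) \<in> A" using A(2)[OF x] subgroup.m_inv_closed[OF As(1) g] by simp
    then have "conjugate x (inv g) \<otimes> g \<in> A" using subgroup.m_closed[OF As(1)] g by simp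
    then show "inv x \<otimes> inv g \<otimes> x \<otimes> g \<in> A" by (simp add: conjugate_def)
  qed
  then have c1: "comm_subgroup G B g \<subseteq> A"
    unfolding comm_subgroup_def using As(1) by (rule generate_subgroup_incl)
  have c1n: "\<one> \<in> comm_subgroup G B g" unfolding comm_subgroup_def by (rule generate.one)
  have "inv y \<otimes> inv g \<otimes> y \<otimes> g = \<one>" if y: "y \<in> comm_subgroup G B g" for y
  proof -
    have yA: "y \<in> A" using y c1 by blast
    have "inv y \<otimes> inv g \<otimes> y \<otimes> g = inv y \<otimes> inv g \<otimes> (g \<otimes> y)"
      using As(2)[OF yA g] Ac[OF yA] Ac[OF g] by (simp add: m_assoc)
    then show ?thesis using Ac[OF yA] Ac[OF g] by (simp add: m_assoc)
  qed
  then have "(\<lambda>x. inv x \<otimes> inv g \<otimes> x \<otimes> g) ` comm_subgroup G B g = {\<one>}" using c1n by force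
  then have "comm_subgroup G (comm_subgroup G B g) g = {\<one>}"
    using generate_one by (simp add: comm_subgroup_def[of G "comm_subgroup G B g"])
  moreover have "p_subgroup p G B" using Bs B(2) by (auto simp: p_subgroup_def)
  ultimately have gC: "g <# C \<in> p_core p (G Mod C)"
    using stab Ac[OF g] unfolding p_stable_def C_def
    by (metis normalizer_normal[OF B(1)] partial_object.update_convs(1) partial_object.surjective)
  define S where "S = {X \<in> carrier (G Mod C). X \<subseteq> M}"
  interpret Q: group "G Mod C" by (rule C.factorgroup_is_group)
  have "subgroup S (G Mod C)"
  proof (rule Q.subgroupI)
    show "S \<subseteq> carrier (G Mod C)" by (auto simp: S_def)
    have "C \<in> S" using Q.one_closed CM by (simp add: S_def)
    then show "S \<noteq> {}" by blast
    fix X assume X: "X \<in> S"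
    have "set_inv X \<subseteq> M" using X subgroup.m_inv_closed[OF M(1)] by (auto simp: SET_INV_def S_def)
    then show "inv\<^bsub>G Mod C\<^esub> X \<in> S" using X Q.inv_closed[of X] by (simp add: S_def C.inv_FactGroup)
    fix Y assume Y: "Y \<in> S"
    have "X <#> Y \<subseteq> M" using X Y subgroup.m_closed[OF M(1)] by (auto simp: set_mult_def S_def)
    then show "X \<otimes>\<^bsub>G Mod C\<^esub> Y \<in> S" using X Y Q.m_closed[of X Y] by (simp add: S_def)
  qed
  moreover have "\<Union>{N. N \<lhd> (G Mod C) \<and> p_subgroup p (G Mod C) N} \<subseteq> S"
  proof (rule Union_least)
    fix N assume "N \<in> {N. N \<lhd> (G Mod C) \<and> p_subgroup p (G Mod C) N}"
    then obtain k where N: "N \<lhd> (G Mod C)" "subgroup N (G Mod C)" "card N = p ^ k"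
      by (auto simp: p_subgroup_def)
    have K: "\<Union>N \<lhd> G" using C.factgroup_subgroup_union_normal[OF N(1)] .
    have "C \<in> N" using subgroup.one_closed[OF N(2)] by simp
    then have CK: "C \<subseteq> \<Union>N" by blast
    have "card (rcosets\<^bsub>G\<lparr>carrier := \<Union>N\<rparr>\<^esub> C) * card C = card (\<Union>N)"
      by (rule lagrange_subgroup[OF C.is_subgroup normal_imp_subgroup[OF K] CK])
    then have "card (\<Union>N) = card C * p ^ k"
      using C.factgroup_subgroup_union_factor[OF N(2)] N(3) by (metis mult.commute)
    then have "\<Union>N \<subseteq> M" using M(2) K CK by (simp add: C_def)
    then show "N \<subseteq> S" using subgroup.subset[OF N(2)] by (auto simp: S_def)
  qed
  ultimately have "p_core p (G Mod C) \<subseteq> S"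
    unfolding p_core_def by (intro Q.generate_subgroup_incl)
  then have "g <# C \<subseteq> M" using gC by (auto simp: S_def)
  moreover have "g \<otimes> \<one> \<in> g <# C" unfolding l_coset_def using C.one_closed by blast
  ultimately show ?thesis using Ac[OF g] by auto
qed

end

locale sylow_group = finite_group +
  fixes p e i :: nat and P :: "'a set"
  assumes p: "Factorial_Ring.prime p"
    and P: "subgroup P G" "card P = p ^ e"
    and index: "order G = card P * i" "\<not> p dvd i"
begin

lemma p_subgroup_conj_into_P:
  assumes "subgroup Q G" "card Q = p ^ n"
  obtains x where "x \<in> carrier G" "\<And>q. q \<in> Q \<Longrightarrow> x \<otimes> q \<otimes> inv x \<in> P"
proof -
  have "card (rcosets P) = i"
    using lagrange[OF P(1)] index(1) card_subgroup_pos[OF P(1)] by simp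
  then show ?thesis using p_subgroup_conj_into[OF p P(1) assms] index(2) that by blast
qed

lemma normal_p_subgroup_subset_P:
  assumes "K \<lhd> G" "card K = p ^ n"
  shows "K \<subseteq> P"
proof
  fix q assume q: "q \<in> K"
  have K: "subgroup K G" using normal_imp_subgroup[OF assms(1)] .
  obtain x where x: "x \<in> carrier G" "\<And>q. q \<in> K \<Longrightarrow> x \<otimes> q \<otimes> inv x \<in> P"
    using p_subgroup_conj_into_P[OF K assms(2)] by blast
  have "x \<otimes> conjugate x q \<otimes> inv x \<in> P" using x normal_conjugate[OF assms(1) x(1) q] by blast
  then show "q \<in> P" using x(1) subgroup.mem_carrier[OF K q] by (simp add: conjugate_def m_assoc)
qed

text \<open>A Sylow subgroup of \<open>K\<close> has a conjugate in \<open>P\<close>, which stays in the normal subgroup \<open>K\<close>. So \<open>K \<inter> P\<close> is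
  at least as large as a Sylow subgroup of \<open>K\<close>.\<close>
lemma sylow_Int_normal:
  assumes "K \<lhd> G"
  obtains m where "card K = card (K \<inter> P) * m" "\<not> p dvd m"
proof -
  have K: "subgroup K G" using normal_imp_subgroup[OF assms(1)] .
  have KP: "subgroup (K \<inter> P) G" using subgroups_Inter_pair[OF K P(1)] .
  interpret K: finite_group "G\<lparr>carrier := K\<rparr>" using finite_group_subgroup[OF K] .
  obtain a m where am: "card K = p ^ a * m" "\<not> p dvd m"
    using multiplicity_decompose'[of "card K" p] card_subgroup_pos[OF K] p
    by (metis not_prime_unit not_less_zero)
  have "order (G\<lparr>carrier := K\<rparr>) = p ^ a * m" using am(1) by (simp add: order_def)
  then obtain Q where Q: "subgroup Q (G\<lparr>carrier := K\<rparr>)" "card Q = p ^ a"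
    using Sylow.sylow_thm[OF p K.is_group _ K.fin] by blast
  have QG: "subgroup Q G" using incl_subgroup[OF K Q(1)] .
  have QK: "Q \<subseteq> K" using subgroup.subset[OF Q(1)] by simp
  obtain x where x: "x \<in> carrier G" "\<And>q. q \<in> Q \<Longrightarrow> x \<otimes> q \<otimes> inv x \<in> P"
    using p_subgroup_conj_into_P[OF QG Q(2)] by blast
  have "conjugate (inv x) ` Q \<subseteq> K \<inter> P"
  proof clarify
    fix q assume q: "q \<in> Q"
    have "conjugate (inv x) q \<in> K" using normal_conjugate[OF assms, of "inv x" q] x(1) QK q by auto
    moreover have "conjugate (inv x) q \<in> P" using x q by (simp add: conjugate_def)
    ultimately show "conjugate (inv x) q \<in> K \<inter> P" by simp
  qed
  moreover have "card (conjugate (inv x) ` Q) = p ^ a"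
    using inj_on_conjugate[of "inv x" Q] x(1) subgroup.subset[OF QG] Q(2) by (simp add: card_image)
  ultimately have ge: "p ^ a \<le> card (K \<inter> P)" using finite_subgroup[OF KP] card_mono by metis
  obtain b where b: "card (K \<inter> P) = p ^ b"
    using card_subgroup_dvd[OF KP P(1)] P(2) divides_primepow_nat[OF p] by (metis inf_le2)
  have "p ^ b dvd p ^ a * m" using card_subgroup_dvd[OF KP K] am(1) b by simp
  moreover have "coprime (p ^ b) m" using am(2) p by (simp add: prime_imp_coprime)
  ultimately have "p ^ b dvd p ^ a" by (simp add: coprime_dvd_mult_left_iff)
  then have "p ^ b \<le> p ^ a" using prime_gt_0_nat[OF p] by (intro dvd_imp_le) auto
  then have "card (K \<inter> P) = p ^ a" using ge b by simp
  then show ?thesis using am by (intro that[of m]) simp_all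
qed

text \<open>The index of \<open>K \<inter> C P\<close> in \<open>K\<close> divides \<open>|K : C|\<close>, a power of \<open>p\<close>, and also divides \<open>|K : K \<inter> P|\<close>, which
  is prime to \<open>p\<close>.\<close>
lemma p_extension_subset_mult_P:
  assumes K: "K \<lhd> G" and C: "C \<lhd> G" "C \<subseteq> K" "card K = card C * p ^ k"
  shows "K \<subseteq> C <#> P"
proof -
  have Ks: "subgroup K G" and Cs: "subgroup C G" using K C(1) normal_imp_subgroup by auto
  have CP: "subgroup (C <#> P) G" by (rule mult_norm_subgroup[OF C(1) P(1)])
  have CCP: "C \<subseteq> C <#> P" and PCP: "P \<subseteq> C <#> P"
    unfolding set_mult_def using subgroup.one_closed[OF P(1)] subgroup.one_closed[OF Cs]
      subgroup.mem_carrier[OF P(1)] subgroup.mem_carrier[OF Cs] by force+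
  define L where "L = K \<inter> (C <#> P)"
  have L: "subgroup L G" unfolding L_def using subgroups_Inter_pair[OF Ks CP] .
  obtain j where j: "card K = card L * j" using card_subgroup_dvd[OF L Ks] by (auto simp: L_def)
  have Lp: "card L > 0" using card_subgroup_pos[OF L] .
  obtain m where m: "card K = card (K \<inter> P) * m" "\<not> p dvd m" using sylow_Int_normal[OF K] .
  have KP: "subgroup (K \<inter> P) G" using subgroups_Inter_pair[OF Ks P(1)] .
  obtain u where u: "card L = card (K \<inter> P) * u"
    using card_subgroup_dvd[OF KP L] PCP by (auto simp: L_def)
  have "m = u * j" using m(1) j u card_subgroup_pos[OF KP] by simp
  then have "\<not> p dvd j" using m(2) by (metis dvd_mult)
  obtain v where v: "card L = card C * v"
    using card_subgroup_dvd[OF Cs L] CCP C(2) unfolding L_def dvd_def by blast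
  have "p ^ k = v * j" using C(3) j v card_subgroup_pos[OF Cs] by simp
  then have "j dvd p ^ k" by simp
  then obtain l where "j = p ^ l" using divides_primepow_nat[OF p] by blast
  with \<open>\<not> p dvd j\<close> have "j = 1" by (cases l) auto
  then have "card L = card K" using j by simp
  then have "L = K" using card_subset_eq[OF finite_subgroup[OF Ks]] by (simp add: L_def)
  then show ?thesis by (auto simp: L_def)
qed

lemma p_core_normal_p_subgroup:
  "p_core p G \<lhd> G" "p_core p G \<subseteq> P"
  "K \<lhd> G \<Longrightarrow> card K = p ^ k \<Longrightarrow> K \<subseteq> p_core p G"
proof -
  let ?U = "\<Union>{N. N \<lhd> G \<and> p_subgroup p G N}"
  have U: "?U \<subseteq> carrier G" using normal_imp_subgroup subgroup.subset by blast
  show "p_core p G \<lhd> G" unfolding p_core_def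
  proof (rule normal_generateI[OF U])
    fix h g assume "h \<in> ?U" and g: "g \<in> carrier G"
    then obtain N where N: "N \<lhd> G" "p_subgroup p G N" "h \<in> N" by auto
    have "g \<otimes> h \<otimes> inv g \<in> N" using normal.inv_op_closed2[OF N(1) g N(3)] .
    then show "g \<otimes> h \<otimes> inv g \<in> ?U" using N by blast
  qed
  have "?U \<subseteq> P" using normal_p_subgroup_subset_P by (auto simp: p_subgroup_def)
  then show "p_core p G \<subseteq> P" unfolding p_core_def using P(1) by (rule generate_subgroup_incl)
  assume K: "K \<lhd> G" "card K = p ^ k"
  have "K \<subseteq> ?U" using K normal_imp_subgroup[OF K(1)] by (auto simp: p_subgroup_def)
  then show "K \<subseteq> p_core p G" unfolding p_core_def by (auto intro: generate.incl)
qed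

text \<open>By conjugacy in \<open>L\<close>, each \<open>g\<close> can be corrected by an element of \<open>L\<close> to normalize \<open>L \<inter> P\<close>, and then
  strong closure makes it normalize \<open>D \<inter> L\<close>.\<close>
lemma frattini_strongly_closed:
  assumes L: "L \<lhd> G" and D: "D \<subseteq> P"
    and closed: "\<And>x g. x \<in> D \<Longrightarrow> g \<in> carrier G \<Longrightarrow> conjugate g x \<in> P \<Longrightarrow> conjugate g x \<in> D"
    and g: "g \<in> carrier G"
  obtains l h where "l \<in> L" "h \<in> carrier G" "g = l \<otimes> h"
    "\<forall>x\<in>D \<inter> L. conjugate h x \<in> D \<inter> L"
proof -
  have Ls: "subgroup L G" using normal_imp_subgroup[OF L] .
  note Lc = subgroup.mem_carrier[OF Ls]
  have LP: "subgroup (L \<inter> P) G" using subgroups_Inter_pair[OF Ls P(1)] .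
  obtain m where m: "card L = card (L \<inter> P) * m" "\<not> p dvd m" using sylow_Int_normal[OF L] .
  define Q where "Q = conjugate g ` (L \<inter> P)"
  have Q: "subgroup Q G" unfolding Q_def by (rule subgroup_conjugate[OF LP g])
  have QL: "Q \<subseteq> L" unfolding Q_def using normal_conjugate[OF L g] by auto
  obtain b where b: "card (L \<inter> P) = p ^ b"
    using card_subgroup_dvd[OF LP P(1)] P(2) divides_primepow_nat[OF p] by (metis inf_le2)
  have cQ: "card Q = p ^ b"
    unfolding Q_def using inj_on_conjugate[OF g] subgroup.subset[OF LP] b by (simp add: card_image)
  obtain y where y: "y \<in> L" "\<And>q. q \<in> Q \<Longrightarrow> y \<otimes> q \<otimes> inv y \<in> L \<inter> P"
    using p_subgroup_conj_into_within[OF p Ls LP _ Q QL cQ m] by blast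
  define h where "h = g \<otimes> inv y"
  have h: "h \<in> carrier G" using g Lc[OF y(1)] by (simp add: h_def)
  have norm: "conjugate h x \<in> L \<inter> P" if x: "x \<in> L \<inter> P" for x
  proof -
    have "y \<otimes> conjugate g x \<otimes> inv y \<in> L \<inter> P" using y(2) x by (simp add: Q_def)
    moreover have "y \<otimes> conjugate g x \<otimes> inv y = conjugate h x"
      unfolding h_def conjugate_def using g Lc[OF y(1)] Lc[of x] x by (simp add: m_assoc inv_mult_group)
    ultimately show ?thesis by simp
  qed
  show ?thesis
  proof (rule that[of "conjugate (inv h) y" h])
    show "conjugate (inv h) y \<in> L" using normal_conjugate[OF L _ y(1)] h by simp
    show "g = conjugate (inv h) y \<otimes> h"
      using h g Lc[OF y(1)] by (simp add: conjugate_def m_assoc) (simp add: h_def m_assoc)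
    show "\<forall>x\<in>D \<inter> L. conjugate h x \<in> D \<inter> L"
      using norm closed h D by auto
  qed (rule h)
qed

end

section \<open>Normality of the intersection of a replacement-closed family\<close>

text \<open>
  The families \<open>\<A>\<^sub>o(D)\<close>, \<open>\<A>\<^sub>r(D)\<close> and \<open>\<A>\<^sub>e(D)\<close> all satisfy these conditions. The last condition lists the
  three properties that the replacement theorem provides, so that its conclusion can be fed back in
  whatever notion of maximality defines the family.
\<close>
locale replacement_closed_family = sylow_group +
  fixes D :: "'a set" and m :: nat and \<F> :: "'a set set"
  assumes odd_p: "odd p" and stable: "p_stable p G"
    and D: "subgroup D G" "D \<subseteq> P"
    and closed: "\<And>x g. x \<in> D \<Longrightarrow> g \<in> carrier G \<Longrightarrow> conjugate g x \<in> P \<Longrightarrow> conjugate g x \<in> D"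
    and \<F>_nonempty: "\<F> \<noteq> {}"
    and \<F>_abelian: "\<And>A. A \<in> \<F> \<Longrightarrow> abelian_subgroup A"
    and \<F>_D: "\<And>A. A \<in> \<F> \<Longrightarrow> A \<subseteq> D"
    and \<F>_replace: "\<And>A R. A \<in> \<F> \<Longrightarrow> abelian_subgroup R \<Longrightarrow> R \<subseteq> D \<Longrightarrow> card A \<le> card R \<Longrightarrow>
      card (torsion p A) \<le> card (torsion p R) \<Longrightarrow> (torsion p A = A \<Longrightarrow> torsion p R = R) \<Longrightarrow> R \<in> \<F>"
begin

definition Z :: "'a set" where "Z = {z \<in> torsion m D. \<forall>A\<in>\<F>. z \<in> A}"

lemma \<F>_subgroup: "A \<in> \<F> \<Longrightarrow> subgroup A G"
  using \<F>_abelian by (simp add: abelian_subgroup_def)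

lemma Z_D: "Z \<subseteq> D" by (auto simp: Z_def torsion_def)
lemma Z_carr: "z \<in> Z \<Longrightarrow> z \<in> carrier G" using subgroup.mem_carrier[OF D(1)] Z_D by blast

lemma Z_abelian: "abelian_subgroup Z"
proof -
  obtain A where A: "A \<in> \<F>" using \<F>_nonempty by blast
  have "subgroup (\<Inter>(torsion m ` \<F>)) G"
    using A \<F>_abelian subgroup_torsion by (intro subgroups_Inter) auto
  moreover have "Z = \<Inter>(torsion m ` \<F>)"
    using A \<F>_D by (auto simp: Z_def torsion_def)
  moreover have "x \<otimes> y = y \<otimes> x" if "x \<in> Z" "y \<in> Z" for x y
    using that \<F>_abelian[OF A] A by (auto simp: Z_def abelian_subgroup_def)
  ultimately show ?thesis by (simp add: abelian_subgroup_def)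
qed

lemma Z_sub: "subgroup Z G" and Z_comm: "x \<in> Z \<Longrightarrow> y \<in> Z \<Longrightarrow> x \<otimes> y = y \<otimes> x"
  using Z_abelian by (auto simp: abelian_subgroup_def)

lemma \<F>_conjugate:
  assumes A: "A \<in> \<F>" and g: "g \<in> carrier G" and sub: "conjugate g ` A \<subseteq> D"
  shows "conjugate g ` A \<in> \<F>"
proof -
  note Ac = subgroup.mem_carrier[OF \<F>_subgroup[OF A]]
  have Asub: "A \<subseteq> carrier G" using Ac by blast
  have "abelian_subgroup (conjugate g ` A)"
    using subgroup_conjugate[OF \<F>_subgroup[OF A] g] \<F>_abelian[OF A] Ac g
    by (auto simp: abelian_subgroup_def conjugate_mult[symmetric])
  moreover have inj: "inj_on (conjugate g) A" using inj_on_conjugate[OF g Asub] .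
  have t: "torsion p (conjugate g ` A) = conjugate g ` torsion p A"
  proof -
    have "conjugate g x [^] p = \<one> \<longleftrightarrow> x [^] p = \<one>" if "x \<in> A" for x
      using g Ac[OF that] by (metis conjugate_cancel(1) conjugate_one(1) conjugate_pow nat_pow_closed one_closed)
    then show ?thesis by (auto simp: torsion_def)
  qed
  moreover have "card (conjugate g ` A) = card A" using inj by (rule card_image)
  moreover have "card (torsion p (conjugate g ` A)) = card (torsion p A)"
    unfolding t using inj_on_subset[OF inj] by (intro card_image) (auto simp: torsion_def)
  ultimately show ?thesis using \<F>_replace[OF A _ sub] by simp
qed

lemma conjugate_preserves_inv:
  assumes "subgroup H G" "g \<in> carrier G" "\<And>x. x \<in> H \<Longrightarrow> conjugate g x \<in> H" "x \<in> H"
  shows "conjugate (inv g) x \<in> H"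
proof -
  have "conjugate g ` H = H"
    using assms(3) inj_on_conjugate[OF assms(2) subgroup.subset[OF assms(1)]]
    by (intro endo_inj_surj[OF finite_subgroup[OF assms(1)]]) auto
  then obtain y where "y \<in> H" "x = conjugate g y" using assms(4) by blast
  then show ?thesis using assms(2) subgroup.mem_carrier[OF assms(1)] by simp
qed

text \<open>An element that normalizes \<open>H\<close> permutes the members of \<open>\<F>\<close> inside \<open>H\<close>, so it normalizes their
  intersection. This is applied with \<open>H = D\<close> and with \<open>H = D \<inter> L\<close>.\<close>
lemma conjugate_Inter_family:
  assumes H: "subgroup H G" "H \<subseteq> D" and h: "h \<in> carrier G" "\<And>x. x \<in> H \<Longrightarrow> conjugate h x \<in> H"
    and z: "z \<in> carrier G" "z [^] m = \<one>" "\<And>A. A \<in> \<F> \<Longrightarrow> A \<subseteq> H \<Longrightarrow> z \<in> A"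
    and A: "A \<in> \<F>" "A \<subseteq> H"
  shows "conjugate h z \<in> A"
proof -
  have "conjugate (inv h) ` A \<subseteq> H" using conjugate_preserves_inv[OF H(1) h] A(2) by blast
  then have "z \<in> conjugate (inv h) ` A"
    using \<F>_conjugate[OF A(1), of "inv h"] h(1) H(2) z(3) by auto
  then show ?thesis using h(1) subgroup.mem_carrier[OF \<F>_subgroup[OF A(1)]] by auto
qed

lemma P_normalizes_Z:
  assumes "g \<in> P" "z \<in> Z" shows "conjugate g z \<in> Z"
proof -
  have g: "g \<in> carrier G" using subgroup.mem_carrier[OF P(1) assms(1)] .
  have gD: "conjugate g x \<in> D" if "x \<in> D" for x
  proof (rule closed[OF that g])
    show "conjugate g x \<in> P"
      using that D(2) assms(1) subgroup.m_closed[OF P(1)] subgroup.m_inv_closed[OF P(1)]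
      by (auto simp: conjugate_def)
  qed
  have zc: "z \<in> D" "z [^] m = \<one>" "\<And>A. A \<in> \<F> \<Longrightarrow> z \<in> A"
    using assms(2) by (auto simp: Z_def torsion_def)
  have "conjugate g z \<in> A" if "A \<in> \<F>" for A
    using conjugate_Inter_family[OF D(1) order_refl g gD Z_carr[OF assms(2)] zc(2,3) that \<F>_D[OF that]]
      that \<F>_D by blast
  moreover have "conjugate g z [^] m = \<one>"
    using zc(2) g Z_carr[OF assms(2)] by (simp add: conjugate_pow[symmetric])
  ultimately show ?thesis using gD[OF zc(1)] by (simp add: Z_def torsion_def)
qed

text \<open>The induction is over all normal \<open>p\<close>-subgroups \<open>B\<close>, because the hypothesis is needed both for the
  normal closure of \<open>Z \<inter> B\<close> and for \<open>B'\<close>. For \<open>B = O\<^sub>p(G)\<close> the intersection is \<open>Z\<close> itself.\<close>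
lemma conjugate_Z_Int_normal_p_subgroup:
  assumes "B \<lhd> G" "card B = p ^ n" "g \<in> carrier G" "z \<in> Z" "z \<in> B"
  shows "conjugate g z \<in> Z"
  using assms
proof (induction "card B" arbitrary: B n g z rule: less_induct)
  case less
  note B = less.prems(1,2)
  have Bs: "subgroup B G" using normal_imp_subgroup[OF B(1)] .
  note Bc = subgroup.mem_carrier[OF Bs] and Pc = subgroup.mem_carrier[OF P(1)]
  have BP: "B \<subseteq> P" using normal_p_subgroup_subset_P[OF B] .
  have smaller: "conjugate g z \<in> Z"
    if N: "N \<lhd> G" "N \<subset> B" and "g \<in> carrier G" "z \<in> Z" "z \<in> N" for N g z
  proof -
    have Ns: "subgroup N G" using normal_imp_subgroup[OF N(1)] .
    have "card N < card B" using N(2) finite_subgroup[OF Bs] psubset_card_mono by blast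
    moreover obtain k where "card N = p ^ k"
      using card_subgroup_dvd[OF Ns Bs] N(2) B(2) divides_primepow_nat[OF p] by (metis psubset_imp_subset)
    ultimately show ?thesis using less.hyps N(1) that(3-5) by blast
  qed
  define W where "W = Z \<inter> B"
  have W: "subgroup W G" unfolding W_def using subgroups_Inter_pair[OF Z_sub Bs] .
  have Wc: "w \<in> carrier G" if "w \<in> W" for w using that Z_carr by (simp add: W_def)
  \<comment> \<open>If the normal closure of \<open>W\<close> is smaller than \<open>B\<close>, the induction hypothesis applies to it.\<close>
  define U where "U = {conjugate g w |g w. g \<in> carrier G \<and> w \<in> W}"
  have Uc: "U \<subseteq> carrier G" using Wc by (auto simp: U_def)
  have UB: "U \<subseteq> B" using normal_conjugate[OF B(1)] by (auto simp: U_def W_def)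
  have Uconj: "conjugate g u \<in> U" if "g \<in> carrier G" "u \<in> U" for g u
  proof -
    obtain h w where u: "h \<in> carrier G" "w \<in> W" "u = conjugate h w" using \<open>u \<in> U\<close> by (auto simp: U_def)
    then have "conjugate g u = conjugate (h \<otimes> g) w" using that(1) Wc by (simp add: conjugate_conjugate)
    then show ?thesis using u that(1) unfolding U_def by blast
  qed
  have gU: "generate G U \<lhd> G"
  proof (rule normal_generateI[OF Uc])
    fix h g assume "h \<in> U" "g \<in> carrier G"
    then show "g \<otimes> h \<otimes> inv g \<in> U" using Uconj[of "inv g" h] by (simp add: conjugate_def)
  qed
  have gUB: "generate G U \<subseteq> B" using UB Bs by (rule generate_subgroup_incl)
  have WU: "W \<subseteq> U"
  proof
    fix w assume w: "w \<in> W"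
    then have "w = conjugate \<one> w" using Wc by simp
    then show "w \<in> U" using w unfolding U_def by blast
  qed
  have zW: "z \<in> W" using less.prems by (simp add: W_def)
  show ?case
  proof (cases "generate G U = B")
    case False
    then have "generate G U \<subset> B" using gUB by blast
    moreover have "z \<in> generate G U" using zW WU by (auto intro: generate.incl)
    ultimately show ?thesis using smaller[OF gU] less.prems(3,4) by blast
  next
    case gen: True
    have B_subI: "B \<subseteq> H" if "subgroup H G" "U \<subseteq> H" for H
      using generate_subgroup_incl[OF that(2,1)] gen by simp
    have BD: "B \<subseteq> D"
    proof (rule B_subI[OF D(1)])
      show "U \<subseteq> D"
      proof
        fix u assume u: "u \<in> U"
        then obtain h w where "h \<in> carrier G" "w \<in> W" "u = conjugate h w" by (auto simp: U_def)
        moreover have "u \<in> P" using u UB BP by blast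
        ultimately show "u \<in> D" using closed[of w h] Z_D by (auto simp: W_def)
      qed
    qed
    show ?thesis
    proof (cases n)
      case 0
      then have "B = {\<one>}" using B(2) subgroup.one_closed[OF Bs] by (auto simp: card_1_singleton_iff)
      then have "z = \<one>" using less.prems by simp
      then show ?thesis using less.prems by simp
    next
      case (Suc k)
      define V where "V = Z \<inter> derived G B"
      have dB: "derived G B \<subset> B" using p_group_not_perfect[OF p Bs B(2)[unfolded Suc]] .
      have dn: "derived G B \<lhd> G" using derived_is_normal[OF B(1)] .
      have V: "subgroup V G"
        unfolding V_def using subgroups_Inter_pair[OF Z_sub normal_imp_subgroup[OF dn]] .
      have Vconj: "conjugate g v \<in> V" if "g \<in> carrier G" "v \<in> V" for g v
        using that smaller[OF dn dB] normal_conjugate[OF dn] by (auto simp: V_def)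
      have Vc: "v \<in> carrier G" if "v \<in> V" for v using subgroup.mem_carrier[OF V that] .
      have comm_derived: "commutator x y \<in> derived G B" if x: "x \<in> B" and y: "y \<in> B" for x y
      proof -
        have "inv x \<otimes> inv y \<otimes> inv (inv x) \<otimes> inv (inv y) \<in> derived_set G B"
          using subgroup.m_inv_closed[OF Bs x] subgroup.m_inv_closed[OF Bs y] by blast
        moreover have "inv x \<otimes> inv y \<otimes> inv (inv x) \<otimes> inv (inv y) = commutator x y"
          using Bc x y by (simp add: commutator_def conjugate_def m_assoc)
        ultimately show ?thesis unfolding derived_def by (auto intro: generate.incl)
      qed
      \<comment> \<open>\<open>[W, B] \<le> Z \<inter> B'\<close> since \<open>B \<le> P\<close> normalizes \<open>Z\<close>, and \<open>V = Z \<inter> B'\<close> is normal by induction. So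
        the conjugates of \<open>W\<close>, and with them \<open>B\<close>, lie in \<open>T\<close>.\<close>
      define T where "T = {x \<in> B. \<forall>y\<in>B. commutator x y \<in> V}"
      have "subgroup T G"
      proof (rule subgroupI)
        show "T \<subseteq> carrier G" using Bc by (auto simp: T_def)
        have "\<one> \<in> T" using subgroup.one_closed[OF Bs] subgroup.one_closed[OF V] Bc
          by (auto simp: T_def commutator_def)
        then show "T \<noteq> {}" by blast
        fix x assume x: "x \<in> T"
        have xB: "x \<in> B" using x by (simp add: T_def)
        have "commutator (inv x) y \<in> V" if y: "y \<in> B" for y
        proof -
          have "commutator (inv x) y = conjugate (inv x) (inv (commutator x y))"
            using Bc[OF xB] Bc[OF y] by (simp add: commutator_def conjugate_def m_assoc inv_mult_group)
          then show ?thesis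
            using Vconj[of "inv x" "inv (commutator x y)"] subgroup.m_inv_closed[OF V] x y Bc[OF xB]
            by (simp add: T_def)
        qed
        then show "inv x \<in> T" using subgroup.m_inv_closed[OF Bs xB] by (simp add: T_def)
        fix x' assume x': "x' \<in> T"
        have xB': "x' \<in> B" using x' by (simp add: T_def)
        have "commutator (x \<otimes> x') y \<in> V" if y: "y \<in> B" for y
        proof -
          have "commutator (x \<otimes> x') y = conjugate x' (commutator x y) \<otimes> commutator x' y"
            using Bc[OF xB] Bc[OF xB'] Bc[OF y]
            by (simp add: commutator_def conjugate_def m_assoc inv_mult_group)
          then show ?thesis
            using Vconj[of x' "commutator x y"] subgroup.m_closed[OF V] x x' y Bc[OF xB']
            by (simp add: T_def)
        qed
        then show "x \<otimes> x' \<in> T" using subgroup.m_closed[OF Bs xB xB'] by (simp add: T_def)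
      qed
      moreover have "U \<subseteq> T"
      proof
        fix u assume u: "u \<in> U"
        obtain h w where hw: "h \<in> carrier G" "w \<in> W" "u = conjugate h w" using u by (auto simp: U_def)
        have wZB: "w \<in> Z" "w \<in> B" using hw by (auto simp: W_def)
        have "commutator u y \<in> V" if y: "y \<in> B" for y
        proof -
          define y' where "y' = conjugate (inv h) y"
          have y': "y' \<in> B" unfolding y'_def using normal_conjugate[OF B(1) _ y] hw(1) by simp
          have "conjugate y' w \<in> Z" using P_normalizes_Z BP y' wZB by blast
          then have "commutator w y' \<in> Z"
            unfolding commutator_def using subgroup.m_closed[OF Z_sub] subgroup.m_inv_closed[OF Z_sub] wZB by simp
          then have "commutator w y' \<in> V" using comm_derived[OF wZB(2) y'] by (simp add: V_def)
          moreover have "commutator u y = conjugate h (commutator w y')"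
            unfolding y'_def hw(3) using hw(1) Bc[OF wZB(2)] Bc[OF y]
            by (simp add: commutator_def conjugate_def m_assoc inv_mult_group)
          ultimately show ?thesis using Vconj hw(1) by simp
        qed
        then show "u \<in> T" using u UB by (auto simp: T_def)
      qed
      ultimately have BT: "B \<subseteq> T" by (rule B_subI)
      then have comm_V: "commutator x y \<in> V" if "x \<in> B" "y \<in> B" for x y
        using that by (auto simp: T_def)
      \<comment> \<open>\<open>V\<close> is centralized by \<open>W\<close>, since \<open>Z\<close> is abelian, and being normal also by the conjugates of \<open>W\<close>.\<close>
      have "U \<subseteq> centralizer G V"
      proof
        fix u assume u: "u \<in> U"
        obtain h w where hw: "h \<in> carrier G" "w \<in> W" "u = conjugate h w" using u by (auto simp: U_def)
        have "u \<otimes> v = v \<otimes> u" if v: "v \<in> V" for v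
        proof -
          have v': "conjugate (inv h) v \<in> V" using Vconj[OF _ v] hw(1) by simp
          then have "w \<otimes> conjugate (inv h) v = conjugate (inv h) v \<otimes> w"
            using Z_comm hw(2) by (auto simp: V_def W_def)
          then have "conjugate h (w \<otimes> conjugate (inv h) v) = conjugate h (conjugate (inv h) v \<otimes> w)" by simp
          then show ?thesis using hw Wc[OF hw(2)] Vc[OF v] by (simp add: conjugate_mult)
        qed
        then show "u \<in> centralizer G V" using u Uc by (auto simp: centralizer_def)
      qed
      moreover have "subgroup (centralizer G V) G" using Vc by (intro subgroup_centralizer) blast
      ultimately have "B \<subseteq> centralizer G V" by (intro B_subI)
      then have comm_central: "commutator x y \<otimes> t = t \<otimes> commutator x y"
        if "x \<in> B" "y \<in> B" "t \<in> B" for x y t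
        using that comm_V[OF that(1,2)] unfolding centralizer_def by fastforce
      define N where "N = {x \<in> carrier G. \<forall>h\<in>W. x \<otimes> h \<otimes> inv x \<in> W}"
      have N: "subgroup N G" unfolding N_def by (rule subgroup_normalizing[OF W finite_subgroup[OF W]])
      have Nconj: "conjugate x w \<in> W" if "x \<in> N" "w \<in> W" for x w
        using subgroup.m_inv_closed[OF N that(1)] that by (auto simp: N_def conjugate_def)
      have PN: "P \<subseteq> N"
      proof
        fix x assume x: "x \<in> P"
        have "x \<otimes> h \<otimes> inv x \<in> W" if h: "h \<in> W" for h
        proof -
          have "conjugate (inv x) h \<in> W"
            unfolding W_def using h P_normalizes_Z subgroup.m_inv_closed[OF P(1) x]
              normal_conjugate[OF B(1), of "inv x" h] Pc[OF x] by (simp add: W_def)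
          then show ?thesis using Pc[OF x] by (simp add: conjugate_def)
        qed
        then show "x \<in> N" using Pc[OF x] by (simp add: N_def)
      qed
      have CN: "centralizer G B \<subseteq> N"
      proof
        fix x assume x: "x \<in> centralizer G B"
        then have xc: "x \<in> carrier G" by (simp add: centralizer_def)
        have "x \<otimes> h \<otimes> inv x = h" if h: "h \<in> W" for h
        proof -
          have "x \<otimes> h = h \<otimes> x" using x h by (simp add: centralizer_def W_def)
          then show ?thesis using xc Wc[OF h] by (simp add: m_assoc)
        qed
        then show "x \<in> N" using xc by (simp add: N_def)
      qed
      \<comment> \<open>The largest normal subgroup of \<open>G\<close> inside the normalizer \<open>N\<close> of \<open>W\<close>\<close>
      define L where "L = {x \<in> carrier G. \<forall>g\<in>carrier G. conjugate g x \<in> N}"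
      have Nc: "x \<in> carrier G" if "x \<in> N" for x using that by (simp add: N_def)
      have L: "L \<lhd> G"
      proof (rule normalI_conjugate)
        show "subgroup L G"
        proof (rule subgroupI)
          show "L \<subseteq> carrier G" by (auto simp: L_def)
          have "\<one> \<in> L" using subgroup.one_closed[OF N] by (simp add: L_def)
          then show "L \<noteq> {}" by blast
          show "inv x \<in> L" if "x \<in> L" for x
            using that subgroup.m_inv_closed[OF N] by (auto simp: L_def conjugate_inv)
          show "x \<otimes> y \<in> L" if "x \<in> L" "y \<in> L" for x y
            using that subgroup.m_closed[OF N] by (auto simp: L_def conjugate_mult)
        qed
        fix g x assume "g \<in> carrier G" "x \<in> L"
        then show "conjugate g x \<in> L" by (auto simp: L_def conjugate_conjugate)
      qed
      have Ls: "subgroup L G" using normal_imp_subgroup[OF L] .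
      have LN: "L \<subseteq> N"
      proof
        fix x assume "x \<in> L"
        then have "conjugate \<one> x \<in> N" "x \<in> carrier G" using one_closed unfolding L_def by blast+
        then show "x \<in> N" by simp
      qed
      have KL: "K \<subseteq> L" if K: "K \<lhd> G" "K \<subseteq> N" for K
        using K(2) normal_conjugate[OF K(1)] Nc by (auto simp: L_def)
      \<comment> \<open>Preimages of normal \<open>p\<close>-subgroups of \<open>G/C\<^sub>G(B)\<close> lie in \<open>C\<^sub>G(B) P\<close>, which normalizes \<open>W\<close>.\<close>
      have p_ext_L: "K \<subseteq> L"
        if K: "K \<lhd> G" "centralizer G B \<subseteq> K" "card K = card (centralizer G B) * p ^ k" for K k
      proof (rule KL[OF K(1)])
        have "K \<subseteq> centralizer G B <#> P"
          by (rule p_extension_subset_mult_P[OF K(1) normal_centralizer[OF B(1)] K(2,3)])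
        also have "\<dots> \<subseteq> N"
          unfolding set_mult_def using CN PN subgroup.m_closed[OF N] by blast
        finally show "K \<subseteq> N" .
      qed
      have normB: "A \<subseteq> L" if A: "A \<in> \<F>" and nA: "\<And>b a. b \<in> B \<Longrightarrow> a \<in> A \<Longrightarrow> conjugate b a \<in> A" for A
      proof
        fix a assume a: "a \<in> A"
        show "a \<in> L"
          by (rule p_stable_mem[OF stable B \<F>_abelian[OF A] _ Ls _ a]) (fact nA p_ext_L)+
      qed
      have DL: "subgroup (D \<inter> L) G" using subgroups_Inter_pair[OF D(1) Ls] .
      \<comment> \<open>Write \<open>g = l h\<close> by the Frattini argument: \<open>l\<close> preserves \<open>W\<close>, and \<open>h\<close> permutes the members of
        \<open>\<F>\<close> inside \<open>D \<inter> L\<close>.\<close>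
      have key: "conjugate g w \<in> A"
        if A: "A \<in> \<F>" "A \<subseteq> L" and g: "g \<in> carrier G" and w: "w \<in> W" for A g w
      proof -
        have "\<exists>l h. l \<in> L \<and> h \<in> carrier G \<and> g = l \<otimes> h \<and> (\<forall>x\<in>D \<inter> L. conjugate h x \<in> D \<inter> L)"
          by (rule frattini_strongly_closed[OF L D(2) _ g]) (use closed in blast)+
        then obtain l h where lh: "l \<in> L" "h \<in> carrier G" "g = l \<otimes> h"
          and hDL: "\<And>x. x \<in> D \<inter> L \<Longrightarrow> conjugate h x \<in> D \<inter> L" by auto
        have w': "conjugate l w \<in> W" using Nconj LN lh(1) w by blast
        then have w'Z: "conjugate l w \<in> Z" by (simp add: W_def)
        have AD: "A \<subseteq> D \<inter> L" using A \<F>_D by blast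
        have "conjugate h (conjugate l w) \<in> A"
          by (rule conjugate_Inter_family[OF DL _ lh(2) hDL Z_carr[OF w'Z] _ _ A(1) AD])
            (use w'Z A AD in \<open>auto simp: Z_def torsion_def\<close>)
        then show ?thesis
          using lh Wc[OF w] subgroup.mem_carrier[OF Ls] by (simp add: conjugate_conjugate)
      qed
      show ?thesis
      proof (cases "\<forall>A\<in>\<F>. A \<subseteq> L")
        case True
        then have inA: "conjugate g z \<in> A" if "A \<in> \<F>" for A
          using key[OF that _ less.prems(3) zW] that by blast
        moreover obtain A where "A \<in> \<F>" using \<F>_nonempty by blast
        then have "conjugate g z \<in> D" using inA \<F>_D by blast
        moreover have "conjugate g z [^] m = \<one>"
          using less.prems(3,4) Z_carr[OF less.prems(4)]
          by (auto simp: conjugate_pow[symmetric] Z_def torsion_def)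
        ultimately show ?thesis by (simp add: Z_def torsion_def)
      next
        case False
        \<comment> \<open>A member outside \<open>L\<close> with largest intersection with \<open>B\<close>, so that its replacement falls into \<open>L\<close>\<close>
        let ?S = "{A \<in> \<F>. \<not> A \<subseteq> L}"
        have "\<F> \<subseteq> Pow (carrier G)" using subgroup.subset[OF \<F>_subgroup] by blast
        then have "finite \<F>" using fin finite_subset by blast
        then have fS: "finite ?S" by simp
        have neS: "?S \<noteq> {}" using False by blast
        obtain A where A: "A \<in> ?S" and mx: "\<And>A'. A' \<in> ?S \<Longrightarrow> card (A' \<inter> B) \<le> card (A \<inter> B)"
          using obtains_MAX[OF fS neS, of "\<lambda>A. card (A \<inter> B)"] fS
          by (metis (no_types, lifting) Max_ge finite_imageI imageI)
        have AF: "A \<in> \<F>" and AL: "\<not> A \<subseteq> L" using A by auto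
        have nn: "\<not> (\<forall>b\<in>B. \<forall>a\<in>A. conjugate b a \<in> A)" using normB[OF AF] AL by blast
        have AP: "A \<subseteq> P" using \<F>_D[OF AF] D(2) by blast
        have VA: "V \<subseteq> A" using AF by (auto simp: V_def Z_def)
        have comm_A: "commutator x y \<in> A" if "x \<in> B" "y \<in> B" for x y
          using comm_V[OF that] VA by blast
        have "\<exists>R. abelian_subgroup R \<and> R \<subseteq> D \<and> A \<inter> B \<subset> R \<inter> B \<and>
            (\<forall>r\<in>R. \<forall>a\<in>A. conjugate r a \<in> A) \<and> card A \<le> card R \<and>
            card (torsion p A) \<le> card (torsion p R) \<and> (torsion p A = A \<longrightarrow> torsion p R = R)"
          by (rule replacement_theorem[OF p odd_p P \<F>_abelian[OF AF] AP B(1) BP _ _ D(1) \<F>_D[OF AF] BD nn])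
            (use comm_A comm_central in blast)+
        then obtain R where R: "abelian_subgroup R" "R \<subseteq> D" "A \<inter> B \<subset> R \<inter> B"
          "\<forall>r\<in>R. \<forall>a\<in>A. conjugate r a \<in> A" "card A \<le> card R"
          "card (torsion p A) \<le> card (torsion p R)" "torsion p A = A \<longrightarrow> torsion p R = R"
          by blast
        have RF: "R \<in> \<F>" using \<F>_replace[OF AF R(1,2,5,6)] R(7) by blast
        have "card (A \<inter> B) < card (R \<inter> B)"
          using R(3) finite_subgroup[OF Bs] by (intro psubset_card_mono) auto
        then have RL: "R \<subseteq> L" using mx[of R] RF by fastforce
        \<comment> \<open>Now all conjugates of \<open>W\<close> lie in \<open>R\<close>, and \<open>R\<close> normalizes \<open>A\<close>.\<close>
        have "B \<subseteq> R"
        proof (rule B_subI[OF \<F>_subgroup[OF RF]])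
          show "U \<subseteq> R" using key[OF RF RL] by (auto simp: U_def)
        qed
        then have False using nn R(4) by blast
        then show ?thesis ..
      qed
    qed
  qed
qed

text \<open>Here \<open>C\<^sub>G(O\<^sub>p(G)) \<le> O\<^sub>p(G)\<close> makes the preimage in \<open>G\<close> of a normal \<open>p\<close>-subgroup of \<open>G/C\<^sub>G(O\<^sub>p(G))\<close> a
  \<open>p\<close>-group, so that \<open>p\<close>-stability puts \<open>Z\<close> into \<open>O\<^sub>p(G)\<close>.\<close>
theorem Z_normal:
  assumes "centralizer G (p_core p G) \<subseteq> p_core p G"
  shows "Z \<lhd> G"
proof -
  let ?O = "p_core p G"
  note On = p_core_normal_p_subgroup(1)
  have Os: "subgroup ?O G" using normal_imp_subgroup[OF On] .
  obtain n where n: "card ?O = p ^ n"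
    using card_subgroup_dvd[OF Os P(1) p_core_normal_p_subgroup(2)] P(2) divides_primepow_nat[OF p] by metis
  have Cs: "subgroup (centralizer G ?O) G" using normal_imp_subgroup[OF normal_centralizer[OF On]] .
  obtain j where j: "card (centralizer G ?O) = p ^ j"
    using card_subgroup_dvd[OF Cs Os assms] n divides_primepow_nat[OF p] by metis
  have "Z \<subseteq> ?O"
  proof
    fix z assume z: "z \<in> Z"
    show "z \<in> ?O"
    proof (rule p_stable_mem[OF stable On n Z_abelian _ Os _ z])
      show "conjugate x a \<in> Z" if "x \<in> ?O" "a \<in> Z" for x a
        using that P_normalizes_Z p_core_normal_p_subgroup(2) by blast
      show "K \<subseteq> ?O" if "K \<lhd> G" "centralizer G ?O \<subseteq> K" "card K = card (centralizer G ?O) * p ^ k" for K k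
        using that(1,3) by (intro p_core_normal_p_subgroup(3)[of K "j + k"]) (simp_all add: j power_add)
    qed
  qed
  then show ?thesis
    using conjugate_Z_Int_normal_p_subgroup[OF On n] by (intro normalI_conjugate[OF Z_sub]) blast
qed

text \<open>An element of all members of \<open>\<F>\<close> commutes with each of them, because they are abelian, and so is central
  in what they generate. The hypothesis supplies the other inclusion.\<close>
lemma torsion_center_generate:
  assumes absorb: "\<And>A z. A \<in> \<F> \<Longrightarrow> z \<in> D \<Longrightarrow> z [^] m = \<one> \<Longrightarrow> \<forall>a\<in>A. z \<otimes> a = a \<otimes> z \<Longrightarrow> z \<in> A"
  shows "torsion m (subgroup_center G (generate G (\<Union>\<F>))) = Z"
proof
  let ?J = "generate G (\<Union>\<F>)"
  have JD: "?J \<subseteq> D" using \<F>_D by (intro generate_subgroup_incl[OF _ D(1)]) blast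
  have AJ: "A \<subseteq> ?J" if "A \<in> \<F>" for A using that by (blast intro: generate.incl)
  show "torsion m (subgroup_center G ?J) \<subseteq> Z"
  proof
    fix z assume "z \<in> torsion m (subgroup_center G ?J)"
    then have z: "z \<in> ?J" "z [^] m = \<one>" "\<And>x. x \<in> ?J \<Longrightarrow> z \<otimes> x = x \<otimes> z"
      by (auto simp: torsion_def subgroup_center_def)
    have "z \<in> A" if A: "A \<in> \<F>" for A
      using absorb[OF A _ z(2)] z(1,3) JD AJ[OF A] by blast
    then show "z \<in> Z" using z JD by (auto simp: Z_def torsion_def)
  qed
  show "Z \<subseteq> torsion m (subgroup_center G ?J)"
  proof
    fix z assume z: "z \<in> Z"
    then have zm: "z [^] m = \<one>" and zA: "\<And>A. A \<in> \<F> \<Longrightarrow> z \<in> A" by (auto simp: Z_def torsion_def)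
    obtain A0 where "A0 \<in> \<F>" using \<F>_nonempty by blast
    then have zJ: "z \<in> ?J" using zA AJ by blast
    have "z \<otimes> x = x \<otimes> z" if x: "x \<in> ?J" for x
    proof (rule generate_commute[OF _ _ _ _ x])
      show "{z} \<subseteq> carrier G" using Z_carr[OF z] by simp
      show "\<Union>\<F> \<subseteq> carrier G" using subgroup.subset[OF \<F>_subgroup] by blast
      show "s \<otimes> t = t \<otimes> s" if s: "s \<in> {z}" and t: "t \<in> \<Union>\<F>" for s t
      proof -
        obtain A where "A \<in> \<F>" "t \<in> A" using t by blast
        then show ?thesis using zA s \<F>_abelian by (auto simp: abelian_subgroup_def)
      qed
      show "z \<in> generate G {z}" by (rule generate.incl) simp
    qed
    then show "z \<in> torsion m (subgroup_center G ?J)"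
      using zJ zm by (simp add: torsion_def subgroup_center_def)
  qed
qed

end

section \<open>The three Thompson subgroups\<close>

context finite_group begin

lemma abelian_subgroups_eq: "abelian_subgroups G H = {A. abelian_subgroup A \<and> A \<subseteq> H}"
proof -
  have "comm_group (G\<lparr>carrier := A\<rparr>) \<longleftrightarrow> (\<forall>x\<in>A. \<forall>y\<in>A. x \<otimes> y = y \<otimes> x)" if A: "subgroup A G" for A
  proof
    assume "comm_group (G\<lparr>carrier := A\<rparr>)"
    then interpret A: comm_group "G\<lparr>carrier := A\<rparr>" .
    show "\<forall>x\<in>A. \<forall>y\<in>A. x \<otimes> y = y \<otimes> x" using A.m_comm by simp
  next
    assume "\<forall>x\<in>A. \<forall>y\<in>A. x \<otimes> y = y \<otimes> x"
    then show "comm_group (G\<lparr>carrier := A\<rparr>)"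
      by (intro group.group_comm_groupI subgroup_imp_group[OF A]) simp
  qed
  then show ?thesis by (auto simp: abelian_subgroups_def abelian_subgroup_def)
qed

lemma elem_abelian_subgroups_eq:
  "elem_abelian_subgroups p G H = {A. abelian_subgroup A \<and> A \<subseteq> H \<and> torsion p A = A}"
  unfolding elem_abelian_subgroups_def abelian_subgroups_eq by (auto simp: torsion_def)

lemma finite_abelian_subgroups: "finite (abelian_subgroups G H)"
proof (rule finite_subset)
  show "abelian_subgroups G H \<subseteq> Pow (carrier G)"
    using subgroup.subset by (auto simp: abelian_subgroups_def)
qed (simp add: fin)

lemma abelian_subgroup_adjoin:
  assumes A: "abelian_subgroup A" and z: "z \<in> carrier G" "\<forall>a\<in>A. z \<otimes> a = a \<otimes> z"
    and H: "subgroup H G" "A \<subseteq> H" "z \<in> H"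
  obtains R where "abelian_subgroup R" "A \<subseteq> R" "z \<in> R" "R \<subseteq> H"
    "torsion p A = A \<and> z [^] p = \<one> \<longrightarrow> torsion p R = R"
proof -
  have As: "subgroup A G" "\<And>x y. x \<in> A \<Longrightarrow> y \<in> A \<Longrightarrow> x \<otimes> y = y \<otimes> x"
    using A by (auto simp: abelian_subgroup_def)
  have gens: "insert z A \<subseteq> carrier G" using z(1) subgroup.subset[OF As(1)] by simp
  have R: "abelian_subgroup (generate G (insert z A))"
    using z(2) As(2) by (intro abelian_subgroup_generate[OF gens]) auto
  show ?thesis
  proof (rule that[OF R])
    show "A \<subseteq> generate G (insert z A)" "z \<in> generate G (insert z A)"
      by (auto intro: generate.incl)
    show "generate G (insert z A) \<subseteq> H" using H by (intro generate_subgroup_incl) auto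
    show "torsion p A = A \<and> z [^] p = \<one> \<longrightarrow> torsion p (generate G (insert z A)) = generate G (insert z A)"
    proof (intro impI)
      assume t: "torsion p A = A \<and> z [^] p = \<one>"
      have "insert z A \<subseteq> torsion p (generate G (insert z A))"
        using t by (auto simp: torsion_def intro: generate.incl)
      then have "generate G (insert z A) \<subseteq> torsion p (generate G (insert z A))"
        using subgroup_torsion[OF R] by (rule generate_subgroup_incl)
      then show "torsion p (generate G (insert z A)) = generate G (insert z A)"
        by (auto simp: torsion_def)
    qed
  qed
qed

end

text \<open>Maximality enters through the first hypothesis: an abelian subgroup of \<open>D\<close> above a member has no
  further elements of the relevant order. It is applied to the subgroup obtained by adjoining \<open>z\<close>.
  For \<open>m = p\<close> adjoining \<open>z\<close> preserves exponent \<open>p\<close>, which the elementary abelian case needs.\<close>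
lemma (in replacement_closed_family) family_absorb:
  assumes mx: "\<And>A R. A \<in> \<F> \<Longrightarrow> abelian_subgroup R \<Longrightarrow> A \<subseteq> R \<Longrightarrow> R \<subseteq> D \<Longrightarrow>
      (torsion p A = A \<Longrightarrow> m = p \<Longrightarrow> torsion p R = R) \<Longrightarrow> torsion m R \<subseteq> A"
    and A: "A \<in> \<F>" and z: "z \<in> D" "z [^] m = \<one>" "\<forall>a\<in>A. z \<otimes> a = a \<otimes> z"
  shows "z \<in> A"
proof -
  have zc: "z \<in> carrier G" using subgroup.mem_carrier[OF D(1) z(1)] .
  obtain R where R: "abelian_subgroup R" "A \<subseteq> R" "z \<in> R" "R \<subseteq> D"
    "torsion p A = A \<and> z [^] p = \<one> \<longrightarrow> torsion p R = R"
    by (rule abelian_subgroup_adjoin[where p = p, OF \<F>_abelian[OF A] zc z(3) D(1) \<F>_D[OF A] z(1)])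
  have "torsion m R \<subseteq> A" using mx[OF A R(1,2,4)] R(5) z(2) by blast
  then show ?thesis using R(3) z(2) by (auto simp: torsion_def)
qed

lemma Max_family_mem:
  fixes w :: "'x \<Rightarrow> nat"
  assumes "finite S" "A \<in> S" "w A = Max (w ` S)" "R \<in> S" "w A \<le> w R"
  shows "w R = Max (w ` S)"
  using assms by (metis Max_ge finite_imageI imageI le_antisym)

theorem theorem2:
  fixes G :: "('a, 'b) monoid_scheme" and p :: nat and P D :: "'a set"
  assumes "Factorial_Ring.prime p" and "odd p"
    and "group G" and "finite (carrier G)"
    and "p_stable p G"
    and "sylow_subgroup p G P"
    and "centralizer G (p_core p G) \<subseteq> p_core p G"
    and "subgroup D G" and "strongly_closed G P D"
  shows "subgroup_center G (J_o G D) \<lhd> G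
       \<and> Omega p G (subgroup_center G (J_r G D)) \<lhd> G
       \<and> Omega p G (subgroup_center G (J_e p G D)) \<lhd> G"
proof -
  interpret finite_group G
    using assms(3,4) by (simp add: finite_group_def finite_group_axioms_def)
  have p: "Factorial_Ring.prime p" by fact
  have P: "subgroup P G" "card P = p ^ multiplicity p (order G)"
    using assms(6) by (auto simp: sylow_subgroup_def)
  have "order G > 0" using fin by (simp add: order_gt_0_iff_finite)
  then obtain i where i: "order G = card P * i" "\<not> p dvd i"
    using multiplicity_decompose'[of "order G" p] p P(2) by (metis not_prime_unit not_less_zero)
  have DP: "D \<subseteq> P" using assms(9) by (simp add: strongly_closed_def)
  have D: "subgroup D G" by fact
  have closed: "conjugate g x \<in> D" if "x \<in> D" "g \<in> carrier G" "conjugate g x \<in> P" for x g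
  proof -
    have e: "inv\<^bsub>G\<^esub> g <#\<^bsub>G\<^esub> {x} #>\<^bsub>G\<^esub> g = {conjugate g x}"
      by (simp add: l_coset_def r_coset_def conjugate_def)
    have "inv\<^bsub>G\<^esub> g <#\<^bsub>G\<^esub> {x} #>\<^bsub>G\<^esub> g \<subseteq> D"
      using assms(9) that unfolding strongly_closed_def by (metis e empty_subsetI insert_subset)
    then show ?thesis unfolding e by simp
  qed
  let ?AS = "abelian_subgroups G D" and ?ES = "elem_abelian_subgroups p G D"
  have fA: "finite ?AS" by (rule finite_abelian_subgroups)
  have fE: "finite ?ES" using fA by (simp add: elem_abelian_subgroups_def)
  have triv: "{\<one>\<^bsub>G\<^esub>} \<in> ?ES"
    using subgroup.one_closed[OF D] triv_subgroup
    by (auto simp: elem_abelian_subgroups_eq abelian_subgroup_def torsion_def)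
  then have neE: "?ES \<noteq> {}" by blast
  then have neA: "?AS \<noteq> {}" by (auto simp: elem_abelian_subgroups_def)
  have rank: "card (torsion p A) = p ^ subgroup_rank G A" if A: "A \<in> ?AS" for A
  proof -
    have A': "abelian_subgroup A" "A \<subseteq> P" using A DP by (auto simp: abelian_subgroups_eq)
    then obtain n where "card A = p ^ n"
      using card_subgroup_dvd[OF _ P(1)] P(2) divides_primepow_nat[OF p] by (metis abelian_subgroup_def)
    then show ?thesis using card_torsion_eq_prime_pow_rank[OF p A'(1)] by simp
  qed
  interpret sylow_group G p "multiplicity p (order G)" i P
    by (intro sylow_group.intro sylow_group_axioms.intro finite_group_axioms p P i)
  have Max_nonempty: "{A \<in> S. w A = Max (w ` S)} \<noteq> {}" if "finite S" "S \<noteq> {}" for S and w :: "'a set \<Rightarrow> nat"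
    using Max_in[of "w ` S"] that by fastforce
  \<comment> \<open>In each interpretation, condition 6 is that the family is nonempty and condition 9 is its closure under
    replacement.\<close>
  interpret o: replacement_closed_family G p "multiplicity p (order G)" i P D 0 "A_o G D"
  proof (intro replacement_closed_family.intro[OF sylow_group_axioms] replacement_closed_family_axioms.intro, goal_cases)
    case 6 then show ?case using Max_nonempty[OF fA neA] by (simp add: A_o_def d_o_def)
  next
    case (9 A R) then show ?case
      using Max_family_mem[OF fA, of A card R] by (auto simp: A_o_def d_o_def abelian_subgroups_eq)
  qed (use assms D DP closed in \<open>auto simp: A_o_def abelian_subgroups_eq\<close>)
  interpret r: replacement_closed_family G p "multiplicity p (order G)" i P D p "A_r G D"
  proof (intro replacement_closed_family.intro[OF sylow_group_axioms] replacement_closed_family_axioms.intro, goal_cases)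
    case 6 then show ?case using Max_nonempty[OF fA neA] by (simp add: A_r_def d_r_def)
  next
    case (9 A R)
    have R: "R \<in> ?AS" using 9 by (simp add: abelian_subgroups_eq)
    have A: "A \<in> ?AS" using 9 by (simp add: A_r_def)
    have "subgroup_rank G A \<le> subgroup_rank G R"
      using 9(5) prime_gt_1_nat[OF p] unfolding rank[OF A] rank[OF R] by simp
    then show ?case
      using Max_family_mem[OF fA A _ R] 9(1) R by (simp add: A_r_def d_r_def)
  qed (use assms D DP closed in \<open>auto simp: A_r_def abelian_subgroups_eq\<close>)
  interpret e: replacement_closed_family G p "multiplicity p (order G)" i P D p "A_e p G D"
  proof (intro replacement_closed_family.intro[OF sylow_group_axioms] replacement_closed_family_axioms.intro, goal_cases)
    case 6 then show ?case using Max_nonempty[OF fE neE] by (simp add: A_e_def d_e_def)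
  next
    case (9 A R) then show ?case
      using Max_family_mem[OF fE, of A card R]
      by (auto simp: A_e_def d_e_def elem_abelian_subgroups_eq)
  qed (use assms D DP closed in \<open>auto simp: A_e_def elem_abelian_subgroups_eq\<close>)
  have Omega: "Omega p G X = Y" if "torsion p X = Y" "subgroup Y G" for X Y
  proof -
    have "Omega p G X = generate G Y" using that(1) by (simp add: Omega_def torsion_def)
    then show ?thesis using generate_subgroup_incl[OF order_refl that(2)] by (auto intro: generate.incl)
  qed
  have "subgroup_center G (J_o G D) = torsion 0 (subgroup_center G (generate G (\<Union>(A_o G D))))"
    by (simp add: J_o_def torsion_def)
  also have "\<dots> = o.Z"
  proof (rule o.torsion_center_generate, rule o.family_absorb)
    fix A R assume A: "A \<in> A_o G D" and R: "abelian_subgroup R" "A \<subseteq> R" "R \<subseteq> D"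
    have "card R \<le> card A" using A R fA by (auto simp: A_o_def d_o_def abelian_subgroups_eq)
    then show "torsion 0 R \<subseteq> A"
      using card_seteq[OF _ R(2)] finite_subgroup R(1) by (auto simp: torsion_def abelian_subgroup_def)
  qed
  finally have "subgroup_center G (J_o G D) \<lhd> G" using o.Z_normal[OF assms(7)] by simp
  moreover have "torsion p (subgroup_center G (J_r G D)) = r.Z"
    unfolding J_r_def
  proof (rule r.torsion_center_generate, rule r.family_absorb)
    fix A R assume A: "A \<in> A_r G D" and R: "abelian_subgroup R" "A \<subseteq> R" "R \<subseteq> D"
    have R': "R \<in> ?AS" and A': "A \<in> ?AS" using A R by (auto simp: A_r_def abelian_subgroups_eq)
    have "subgroup_rank G R \<le> subgroup_rank G A" using A R' fA by (auto simp: A_r_def d_r_def)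
    then have "card (torsion p R) \<le> card (torsion p A)"
      unfolding rank[OF A'] rank[OF R'] using prime_gt_0_nat[OF p] by (intro power_increasing) auto
    moreover have "torsion p A \<subseteq> torsion p R" using R(2) by (auto simp: torsion_def)
    moreover have "finite (torsion p R)" using finite_subgroup R(1) by (auto simp: torsion_def abelian_subgroup_def)
    ultimately have "torsion p A = torsion p R" by (intro card_seteq)
    then show "torsion p R \<subseteq> A" by (auto simp: torsion_def)
  qed
  then have "Omega p G (subgroup_center G (J_r G D)) \<lhd> G"
    using Omega[OF _ r.Z_sub] r.Z_normal[OF assms(7)] by simp
  moreover have "torsion p (subgroup_center G (J_e p G D)) = e.Z"
    unfolding J_e_def
  proof (rule e.torsion_center_generate, rule e.family_absorb)
    fix A R assume A: "A \<in> A_e p G D" and R: "abelian_subgroup R" "A \<subseteq> R" "R \<subseteq> D"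
      and t: "torsion p A = A \<Longrightarrow> p = p \<Longrightarrow> torsion p R = R"
    have "card R \<le> card A" using A R t fE by (auto simp: A_e_def d_e_def elem_abelian_subgroups_eq)
    then show "torsion p R \<subseteq> A"
      using card_seteq[OF _ R(2)] finite_subgroup R(1) by (auto simp: torsion_def abelian_subgroup_def)
  qed
  then have "Omega p G (subgroup_center G (J_e p G D)) \<lhd> G"
    using Omega[OF _ e.Z_sub] e.Z_normal[OF assms(7)] by simp
  ultimately show ?thesis by simp
qed

end
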